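(* Let $R$ be a field of characteristic zero and let $\mathfrak g$ be a reductive Lie algebra over $R$. The Weil coalgebra $W'[\mathfrak g]$ admits a $\mathfrak g$-equivariant contracting homotopy.
   Context: $s$ denotes suspension. The cone $C\mathfrak g$ is the differential graded Lie algebra with $(C\mathfrak g)_0=\mathfrak g$, $(C\mathfrak g)_1=s\mathfrak g$, $d(sY)=Y$, $s\mathfrak g$ abelian, $[Y,sZ]=s[Y,Z]$. The Weil coalgebra $W'[\mathfrak g]$ is the CCE coalgebra $\mathrm S'_\partial[sC\mathfrak g]$ of the differential graded Lie algebra $C\mathfrak g$: the cofree coaugmented graded cocommutative coalgebra $\mathrm S'[sC\mathfrak g]\cong\mathrm S'[s^2\mathfrak g]\otimes\Lambda'[s\mathfrak g]$ on $sC\mathfrak g$, with differential $d+\partial$, where $d$ is induced by the differential of $C\mathfrak g$ and $\partial$ is the coderivation determined by the Lie bracket, i.e. $\tau\partial=\frac12[\tau,\tau]$ (cup bracket) for $\tau\colon\mathrm S'[sC\mathfrak g]\to C\mathfrak g$ the desuspension on $sC\mathfrak g$ and zero on the other homogeneous constituents. $\mathfrak g$ acts on $W'[\mathfrak g]$ by the adjoint action. A $\mathfrak g$-equivariant contracting homotopy is a $\mathfrak g$-linear map $h\colon W'[\mathfrak g]\to W'[\mathfrak g]$ of degree $1$ with $Dh=(d+\partial)h+h(d+\partial)=\mathrm{Id}-\eta\varepsilon$, where $\varepsilon\colon W'[\mathfrak g]\to R$ is the counit and $\eta\colon R\to W'[\mathfrak g]$ the coaugmentation. *)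

theory Defs
  imports Complex_Main "HOL-Library.Product_Plus"
begin

section \<open>Lie algebras\<close>

locale lie_algebra = vector_space scale
  for scale :: "'k::field_char_0 \<Rightarrow> 'g::ab_group_add \<Rightarrow> 'g" +
  fixes bracket :: "'g \<Rightarrow> 'g \<Rightarrow> 'g"
  assumes linear_left: "Vector_Spaces.linear scale scale (\<lambda>x. bracket x y)"
    and linear_right: "Vector_Spaces.linear scale scale (bracket x)"
    and alternating: "bracket x x = 0"
    and jacobi: "bracket x (bracket y z) + bracket y (bracket z x) + bracket z (bracket x y) = 0"

definition lie_ideal :: "('k::field_char_0 \<Rightarrow> 'g::ab_group_add \<Rightarrow> 'g) \<Rightarrow> ('g \<Rightarrow> 'g \<Rightarrow> 'g) \<Rightarrow> 'g set \<Rightarrow> bool"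
  where "lie_ideal scale bracket I \<longleftrightarrow>
    module.subspace scale I \<and> (\<forall>x. \<forall>y\<in>I. bracket x y \<in> I)"

text \<open>
  A Lie algebra is reductive when its adjoint representation is semisimple. The
  subrepresentations of the adjoint representation are the ideals, so this says that every ideal
  has a complementary ideal. Finite-dimensionality is not required.
\<close>

definition reductive :: "('k::field_char_0 \<Rightarrow> 'g::ab_group_add \<Rightarrow> 'g) \<Rightarrow> ('g \<Rightarrow> 'g \<Rightarrow> 'g) \<Rightarrow> bool"
  where "reductive scale bracket \<longleftrightarrow>
    (\<forall>I. lie_ideal scale bracket I \<longrightarrow>
      (\<exists>J. lie_ideal scale bracket J \<and> I \<inter> J = {0} \<and> (\<forall>z. \<exists>x\<in>I. \<exists>y\<in>J. z = x + y)))"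


section \<open>Differential graded Lie algebras\<close>

text \<open>
  The grading is carried by a homogeneous basis: \<open>deg\<close> is only meaningful on elements of
  \<open>basis\<close>, and the homogeneous constituent of degree \<open>n\<close> is the span of the basis elements of
  degree \<open>n\<close>. The differential lowers degree by one.
\<close>

record ('k, 'a) dgl =
  scl :: "'k \<Rightarrow> 'a \<Rightarrow> 'a"
  basis :: "'a set"
  deg :: "'a \<Rightarrow> nat"
  brk :: "'a \<Rightarrow> 'a \<Rightarrow> 'a"
  dif :: "'a \<Rightarrow> 'a"

definition grade :: "('k::field_char_0, 'a::ab_group_add) dgl \<Rightarrow> nat \<Rightarrow> 'a set"
  where "grade L n = module.span (scl L) {b \<in> basis L. deg L b = n}"

locale dg_lie_algebra =
  fixes L :: "('k::field_char_0, 'a::ab_group_add) dgl"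
  assumes vector_space: "vector_space (scl L)"
    and independent_basis: "\<not> module.dependent (scl L) (basis L)"
    and span_basis: "module.span (scl L) (basis L) = UNIV"
    and linear_dif: "Vector_Spaces.linear (scl L) (scl L) (dif L)"
    and linear_brk_left: "Vector_Spaces.linear (scl L) (scl L) (\<lambda>x. brk L x y)"
    and linear_brk_right: "Vector_Spaces.linear (scl L) (scl L) (brk L x)"
    and dif_grade_0: "x \<in> grade L 0 \<Longrightarrow> dif L x = 0"
    and dif_grade_Suc: "x \<in> grade L (Suc n) \<Longrightarrow> dif L x \<in> grade L n"
    and brk_grade: "x \<in> grade L m \<Longrightarrow> y \<in> grade L n \<Longrightarrow> brk L x y \<in> grade L (m + n)"
    and dif_dif: "dif L (dif L x) = 0"
    and dif_brk: "x \<in> grade L m \<Longrightarrow>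
      dif L (brk L x y) = brk L (dif L x) y + scl L ((-1) ^ m) (brk L x (dif L y))"
    and brk_antisym: "x \<in> grade L m \<Longrightarrow> y \<in> grade L n \<Longrightarrow>
      brk L x y = - scl L ((-1) ^ (m * n)) (brk L y x)"
    and brk_jacobi: "x \<in> grade L m \<Longrightarrow> y \<in> grade L n \<Longrightarrow>
      brk L x (brk L y z) = brk L (brk L x y) z + scl L ((-1) ^ (m * n)) (brk L y (brk L x z))"

text \<open>The pair \<open>(Y, Z)\<close> stands for \<open>Y + sZ\<close>, with \<open>Y\<close> in degree 0 and \<open>sZ\<close> in degree 1.\<close>

definition cone :: "('k::field_char_0 \<Rightarrow> 'g::ab_group_add \<Rightarrow> 'g) \<Rightarrow> ('g \<Rightarrow> 'g \<Rightarrow> 'g) \<Rightarrow> 'g set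
    \<Rightarrow> ('k, 'g \<times> 'g) dgl"
  where "cone scale bracket B =
    \<lparr> scl = (\<lambda>r (Y, Z). (scale r Y, scale r Z)),
      basis = (\<lambda>b. (b, 0)) ` B \<union> (\<lambda>b. (0, b)) ` B,
      deg = (\<lambda>(Y, Z). if Z = 0 then 0 else 1),
      brk = (\<lambda>(Y, Z) (Y', Z'). (bracket Y Y', bracket Y Z' + bracket Z Y')),
      dif = (\<lambda>(Y, Z). (Z, 0)) \<rparr>"

lemma dg_lie_algebra_cone:
  assumes "lie_algebra scale bracket"
    and ind: "\<not> module.dependent scale B" and spn: "module.span scale B = UNIV"
  shows "dg_lie_algebra (cone scale bracket B)"
proof -
  interpret lie_algebra scale bracket by fact
  define L where "L = cone scale bracket B"
  note L = L_def cone_def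
  have add_l [simp]: "bracket (x + y) z = bracket x z + bracket y z"
    and scale_l [simp]: "bracket (scale r x) z = scale r (bracket x z)" for x y z r
    using linear_left[of z] unfolding Vector_Spaces.linear_iff by blast+
  have add_r [simp]: "bracket z (x + y) = bracket z x + bracket z y"
    and scale_r [simp]: "bracket z (scale r x) = scale r (bracket z x)" for x y z r
    using linear_right[of z] unfolding Vector_Spaces.linear_iff by blast+
  have vs: "vector_space (scl L)"
    by (unfold_locales) (auto simp: L algebra_simps)
  interpret P: vector_space "scl L" by (rule vs)
  have zero: "0 \<notin> B"
    using ind dependent_zero by blast
  have zl [simp]: "bracket 0 y = 0" and zr [simp]: "bracket y 0 = 0" for y
    using scale_l[of 0 0 y] scale_r[of y 0 0] by simp_all
  have neg_r: "bracket x (- y) = - bracket x y" for x y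
    using scale_r[of x "-1" y] by simp
  have anti: "bracket x y = - bracket y x" for x y
  proof -
    have "bracket (x + y) (x + y) = bracket x y + bracket y x"
      unfolding add_l add_r by (simp add: alternating add.commute)
    then show ?thesis by (simp add: alternating eq_neg_iff_add_eq_0)
  qed
  have jac: "bracket x (bracket y z) = bracket (bracket x y) z + bracket y (bracket x z)" for x y z
  proof -
    have "bracket y (bracket z x) = - bracket y (bracket x z)"
      using anti[of z x] neg_r by simp
    moreover have "bracket z (bracket x y) = - bracket (bracket x y) z"
      by (rule anti)
    ultimately show ?thesis
      using jacobi[of x y z] by (simp add: algebra_simps)
  qed
  have e0: "{b \<in> basis L. deg L b = 0} = (\<lambda>b. (b, 0)) ` B"
    and e1: "{b \<in> basis L. deg L b = 1} = (\<lambda>b. (0, b)) ` B"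
    using zero by (auto simp: L split: if_splits)
  have inl: "module_hom scale (scl L) (\<lambda>Y. (Y, 0))" and inr: "module_hom scale (scl L) (\<lambda>Z. (0, Z))"
    by (unfold_locales, auto simp: L)+
  have g0: "grade L 0 = range (\<lambda>Y. (Y, 0))"
    unfolding grade_def e0 using module_hom.span_image[OF inl] spn by simp
  have g1: "grade L 1 = range (\<lambda>Z. (0, Z))"
    unfolding grade_def e1 using module_hom.span_image[OF inr] spn by simp
  have gn: "grade L (Suc (Suc n)) = {0}" for n
  proof -
    have "{b \<in> basis L. deg L b = Suc (Suc n)} = {}" by (auto simp: L)
    then show ?thesis unfolding grade_def by (simp only: P.span_empty)
  qed
  have cases: "(m = 0 \<and> snd x = 0) \<or> (m = 1 \<and> fst x = 0) \<or> (m \<ge> 2 \<and> x = 0)"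
    if "x \<in> grade L m" for x m
  proof -
    consider "m = 0" | "m = 1" | n where "m = Suc (Suc n)"
      by (metis One_nat_def old.nat.exhaust)
    then show ?thesis
      using that g0 g1 gn by cases auto
  qed
  have span: "P.span (basis L) = UNIV"
  proof -
    have "(Y, Z) \<in> P.span (basis L)" for Y Z
    proof -
      have "(Y, 0) \<in> P.span (basis L)" "(0, Z) \<in> P.span (basis L)"
        using g0 g1 P.span_mono[of "{b \<in> basis L. deg L b = 0}" "basis L"]
          P.span_mono[of "{b \<in> basis L. deg L b = 1}" "basis L"]
        unfolding grade_def by blast+
      then have "(Y, 0) + (0, Z) \<in> P.span (basis L)" by (rule P.span_add)
      then show ?thesis by simp
    qed
    then show ?thesis by auto
  qed
  have indep: "P.independent (basis L)"
  proof -
    have fst_hom: "module_hom (scl L) scale fst" and snd_hom: "module_hom (scl L) scale snd"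
      by (unfold_locales, auto simp: L)+
    have *: "b \<notin> span (B - {b})" if "b \<in> B" for b
      using ind that by (auto simp: dependent_def)
    have "b \<notin> P.span (basis L - {b})" if b: "b \<in> basis L" for b
    proof
      assume a: "b \<in> P.span (basis L - {b})"
      from b consider c where "c \<in> B" "b = (c, 0)" | c where "c \<in> B" "b = (0, c)"
        by (auto simp: L)
      then show False
      proof cases
        case 1
        have "c \<in> span (fst ` (basis L - {b}))"
          using a 1 module_hom.span_image[OF fst_hom, of "basis L - {b}"] by force
        moreover have "fst ` (basis L - {b}) \<subseteq> insert 0 (B - {c})"
          using 1 by (auto simp: L)
        ultimately have "c \<in> span (B - {c})"
          by (metis span_insert_0 span_mono subsetD)
        with * 1 show False by blast
      next
        case 2
        have "c \<in> span (snd ` (basis L - {b}))"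
          using a 2 module_hom.span_image[OF snd_hom, of "basis L - {b}"] by force
        moreover have "snd ` (basis L - {b}) \<subseteq> insert 0 (B - {c})"
          using 2 by (auto simp: L)
        ultimately have "c \<in> span (B - {c})"
          by (metis span_insert_0 span_mono subsetD)
        with * 2 show False by blast
      qed
    qed
    then show ?thesis by (auto simp: P.dependent_def)
  qed
  have gr0: "(Y, 0) \<in> grade L 0" and gr1: "(0, Z) \<in> grade L (Suc 0)" and grz: "0 \<in> grade L n"
    for Y Z n
    using g0 g1 by (auto simp: grade_def P.span_zero)
  have "dg_lie_algebra L"
  proof (rule dg_lie_algebra.intro)
    show "vector_space (scl L)" by (rule vs)
    show "P.independent (basis L)" by (rule indep)
    show "P.span (basis L) = UNIV" by (rule span)
    show "Vector_Spaces.linear (scl L) (scl L) (dif L)"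
      using vs by (auto simp: Vector_Spaces.linear_iff L)
    show "Vector_Spaces.linear (scl L) (scl L) (\<lambda>x. brk L x y)" for y
      using vs by (auto simp: Vector_Spaces.linear_iff L algebra_simps split: prod.splits)
    show "Vector_Spaces.linear (scl L) (scl L) (brk L x)" for x
      using vs by (auto simp: Vector_Spaces.linear_iff L algebra_simps split: prod.splits)
    show "dif L x = 0" if "x \<in> grade L 0" for x
      using cases[OF that] by (auto simp: L zero_prod_def split: prod.splits)
    show "dif L x \<in> grade L n" if "x \<in> grade L (Suc n)" for x n
      using cases[OF that] gr0 grz by (auto simp: L zero_prod_def split: prod.splits)
    show "brk L x y \<in> grade L (m + n)" if "x \<in> grade L m" "y \<in> grade L n" for x y m n
      using cases[OF that(1)] cases[OF that(2)] gr0 gr1 grz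
      by (cases x; cases y) (auto simp: L zero_prod_def)
    show "dif L (dif L x) = 0" for x
      by (auto simp: L zero_prod_def split: prod.splits)
    show "dif L (brk L x y) = brk L (dif L x) y + scl L ((-1) ^ m) (brk L x (dif L y))"
      if "x \<in> grade L m" for x y m
      using cases[OF that]
      by (cases x; cases y) (auto simp: L zero_prod_def)
    show "brk L x y = - scl L ((-1) ^ (m * n)) (brk L y x)"
      if "x \<in> grade L m" "y \<in> grade L n" for x y m n
      using cases[OF that(1)] cases[OF that(2)] anti[of "fst x" "fst y"]
        anti[of "fst x" "snd y"] anti[of "snd x" "fst y"]
      by (auto simp: L prod_eq_iff split_beta)
    show "brk L x (brk L y z) = brk L (brk L x y) z + scl L ((-1) ^ (m * n)) (brk L y (brk L x z))"
      if "x \<in> grade L m" "y \<in> grade L n" for x y z m n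
      using cases[OF that(1)] cases[OF that(2)] jac[of "fst x" "fst y" "fst z"]
        jac[of "fst x" "fst y" "snd z"] jac[of "snd x" "fst y" "fst z"] jac[of "fst x" "snd y" "fst z"]
      by (auto simp: L prod_eq_iff split_beta)
  qed
  then show ?thesis by (simp add: L_def)
qed


section \<open>The graded symmetric coalgebra on the suspension\<close>

text \<open>
  A word \<open>[b1, ..., bn]\<close> over \<open>basis L\<close> stands for the basis element \<open>sb1 \<otimes> ... \<otimes> sbn\<close> of the
  tensor coalgebra on \<open>sL\<close>, and a function on words is the family of coordinates of an element.
  The coalgebra \<open>sym_coalg L\<close>, that is \<open>S'[sL]\<close>, consists of the elements of the tensor coalgebra
  that are invariant under the symmetric groups acting with the Koszul sign. Its comultiplication
  is the restriction of deconcatenation; in coordinates with respect to pairs of words, it sends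
  \<open>f\<close> to \<open>\<lambda>(u, v). f (u @ v)\<close>.
\<close>

definition wdeg :: "('k, 'a) dgl \<Rightarrow> 'a list \<Rightarrow> nat"
  where "wdeg L w = (\<Sum>b\<leftarrow>w. deg L b + 1)"

definition sym_coalg :: "('k::field_char_0, 'a) dgl \<Rightarrow> ('a list \<Rightarrow> 'k) set"
  where "sym_coalg L = {f.
    finite {w. f w \<noteq> 0} \<and>
    (\<forall>w. f w \<noteq> 0 \<longrightarrow> set w \<subseteq> basis L) \<and>
    (\<forall>u x y v. f (u @ [x, y] @ v) = (-1) ^ ((deg L x + 1) * (deg L y + 1)) * f (u @ [y, x] @ v))}"

definition sym_coalg_hom :: "('k::field_char_0, 'a) dgl \<Rightarrow> nat \<Rightarrow> ('a list \<Rightarrow> 'k) set"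
  where "sym_coalg_hom L n = {f \<in> sym_coalg L. \<forall>w. f w \<noteq> 0 \<longrightarrow> wdeg L w = n}"

definition comult :: "('a list \<Rightarrow> 'k) \<Rightarrow> 'a list \<times> 'a list \<Rightarrow> 'k"
  where "comult f = (\<lambda>(u, v). f (u @ v))"

definition counit :: "('a list \<Rightarrow> 'k) \<Rightarrow> 'k"
  where "counit f = f []"

definition coaug :: "'k::zero \<Rightarrow> 'a list \<Rightarrow> 'k"
  where "coaug r = (\<lambda>w. if w = [] then r else 0)"

text \<open>The maps \<open>\<psi> \<otimes> Id\<close> and \<open>Id \<otimes> \<psi>\<close>, for \<open>\<psi>\<close> of a degree with the parity of \<open>k\<close>.\<close>

definition tensor_left :: "(('a list \<Rightarrow> 'k) \<Rightarrow> 'a list \<Rightarrow> 'k) \<Rightarrow> ('a list \<times> 'a list \<Rightarrow> 'k)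
    \<Rightarrow> 'a list \<times> 'a list \<Rightarrow> 'k"
  where "tensor_left \<psi> F = (\<lambda>(u, v). \<psi> (\<lambda>u'. F (u', v)) u)"

definition tensor_right :: "('k::field_char_0, 'a) dgl \<Rightarrow> nat \<Rightarrow> (('a list \<Rightarrow> 'k) \<Rightarrow> 'a list \<Rightarrow> 'k)
    \<Rightarrow> ('a list \<times> 'a list \<Rightarrow> 'k) \<Rightarrow> 'a list \<times> 'a list \<Rightarrow> 'k"
  where "tensor_right L k \<psi> F = (\<lambda>(u, v). (-1) ^ (k * wdeg L u) * \<psi> (\<lambda>v'. F (u, v')) v)"

definition is_coderivation :: "('k::field_char_0, 'a) dgl \<Rightarrow> nat
    \<Rightarrow> (('a list \<Rightarrow> 'k) \<Rightarrow> 'a list \<Rightarrow> 'k) \<Rightarrow> bool"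
  where "is_coderivation L k \<psi> \<longleftrightarrow> (\<forall>f \<in> sym_coalg L. \<forall>p.
    comult (\<psi> f) p = tensor_left \<psi> (comult f) p + tensor_right L k \<psi> (comult f) p)"

text \<open>
  The desuspension \<open>\<tau>\<close>, extended by zero on words of length other than one, and the cup bracket
  \<open>[\<alpha>, \<beta>] = [ , ] \<circ> (\<alpha> \<otimes> \<beta>) \<circ> \<Delta>\<close> of linear maps with values in \<open>L\<close>, where the parity of the
  degree of \<open>\<beta>\<close> is that of \<open>n\<close>.
\<close>

definition tau :: "('k::field_char_0, 'a::ab_group_add) dgl \<Rightarrow> ('a list \<Rightarrow> 'k) \<Rightarrow> 'a"
  where "tau L f = (\<Sum>b | f [b] \<noteq> 0. scl L (f [b]) b)"

definition word :: "'a list \<Rightarrow> 'a list \<Rightarrow> 'k::field_char_0"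
  where "word u = (\<lambda>w. if w = u then 1 else 0)"

definition cup_bracket :: "('k::field_char_0, 'a::ab_group_add) dgl \<Rightarrow> (('a list \<Rightarrow> 'k) \<Rightarrow> 'a)
    \<Rightarrow> nat \<Rightarrow> (('a list \<Rightarrow> 'k) \<Rightarrow> 'a) \<Rightarrow> ('a list \<Rightarrow> 'k) \<Rightarrow> 'a"
  where "cup_bracket L \<alpha> n \<beta> f =
    (\<Sum>(u, v) | comult f (u, v) \<noteq> 0.
      scl L ((-1) ^ (n * wdeg L u) * comult f (u, v)) (brk L (\<alpha> (word u)) (\<beta> (word v))))"

text \<open>
  \<open>coder L k \<alpha>\<close> is the coderivation \<open>\<psi>\<close> with \<open>\<tau> \<circ> \<psi> = \<alpha>\<close>, for \<open>\<psi>\<close> of a degree with the parity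
  of \<open>k\<close>. The formula is that of the sum of the maps \<open>Id \<otimes> s\<alpha> \<otimes> Id\<close> applied to the iterated
  coproduct; the lemmas below show that it has, and on \<open>sym_coalg L\<close> is determined by, this
  property.
\<close>

definition coder :: "('k::field_char_0, 'a::ab_group_add) dgl \<Rightarrow> nat \<Rightarrow> (('a list \<Rightarrow> 'k) \<Rightarrow> 'a)
    \<Rightarrow> ('a list \<Rightarrow> 'k) \<Rightarrow> 'a list \<Rightarrow> 'k"
  where "coder L k \<alpha> f w =
    (\<Sum>i<length w. (-1) ^ (k * wdeg L (take i w)) *
      module.representation (scl L) (basis L)
        (\<alpha> (\<lambda>m. f (take i w @ m @ drop (Suc i) w))) (w ! i))"

lemma slice_sym_coalg:
  assumes "f \<in> sym_coalg L"
  shows "(\<lambda>m. f (u @ m @ v)) \<in> sym_coalg L"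
proof -
  have "finite ((\<lambda>m. u @ m @ v) -` {w. f w \<noteq> 0})"
    by (rule finite_vimageI) (use assms in \<open>auto simp: sym_coalg_def inj_on_def\<close>)
  moreover have "f (u @ (u' @ [x, y] @ v') @ v)
      = (-1) ^ ((deg L x + 1) * (deg L y + 1)) * f (u @ (u' @ [y, x] @ v') @ v)" for u' x y v'
  proof -
    have "f ((u @ u') @ [x, y] @ (v' @ v))
      = (-1) ^ ((deg L x + 1) * (deg L y + 1)) * f ((u @ u') @ [y, x] @ (v' @ v))"
      using assms unfolding sym_coalg_def by blast
    then show ?thesis by simp
  qed
  moreover have "set w \<subseteq> basis L" if "f (u @ w @ v) \<noteq> 0" for w
  proof -
    have "set (u @ w @ v) \<subseteq> basis L"
      using assms that unfolding sym_coalg_def by blast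
    then show ?thesis by simp
  qed
  ultimately show ?thesis
    unfolding sym_coalg_def vimage_def mem_Collect_eq by blast
qed

lemma coder_append:
  "coder L k \<alpha> f (u @ v) = coder L k \<alpha> (\<lambda>u'. f (u' @ v)) u
     + (-1) ^ (k * wdeg L u) * coder L k \<alpha> (\<lambda>v'. f (u @ v')) v"
proof -
  let ?t = "\<lambda>f w i. (-1) ^ (k * wdeg L (take i w)) *
      module.representation (scl L) (basis L)
        (\<alpha> (\<lambda>m. f (take i w @ m @ drop (Suc i) w))) (w ! i)"
  have "coder L k \<alpha> f (u @ v) = (\<Sum>i<length u. ?t f (u @ v) i)
      + (\<Sum>i=length u..<length u + length v. ?t f (u @ v) i)"
    using sum.atLeastLessThan_concat[of 0 "length u" "length u + length v" "?t f (u @ v)"]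
    by (simp only: coder_def length_append atLeast0LessThan le_add1 zero_le)
  also have "(\<Sum>i<length u. ?t f (u @ v) i) = coder L k \<alpha> (\<lambda>u'. f (u' @ v)) u"
    unfolding coder_def by (rule sum.cong) (simp_all add: nth_append)
  also have "(\<Sum>i=length u..<length u + length v. ?t f (u @ v) i)
      = (\<Sum>i<length v. ?t f (u @ v) (length u + i))"
    using sum.shift_bounds_nat_ivl[of "?t f (u @ v)" 0 "length u" "length v"]
    by (simp add: atLeast0LessThan add.commute)
  also have "\<dots> = (-1) ^ (k * wdeg L u) * coder L k \<alpha> (\<lambda>v'. f (u @ v')) v"
    unfolding coder_def sum_distrib_left
    by (rule sum.cong)
      (simp_all add: nth_append wdeg_def distrib_left power_add mult.assoc Suc_diff_le)
  finally show ?thesis .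
qed

lemma is_coderivation_coder: "is_coderivation L k (coder L k \<alpha>)"
  by (simp add: is_coderivation_def comult_def tensor_left_def tensor_right_def coder_append
      split_beta)

lemma (in dg_lie_algebra) tau_coder: "tau L (coder L k \<alpha> f) = \<alpha> f"
proof -
  interpret vector_space "scl L" by (rule vector_space)
  show ?thesis
    using sum_nonzero_representation_eq[of "basis L" "\<alpha> f"] independent_basis span_basis
    by (simp add: tau_def coder_def wdeg_def)
qed

lemma (in dg_lie_algebra) coder_unique:
  assumes \<psi>: "is_coderivation L k \<psi>" "\<And>f. f \<in> sym_coalg L \<Longrightarrow> \<psi> f \<in> sym_coalg L"
    and tau: "\<And>f. f \<in> sym_coalg L \<Longrightarrow> tau L (\<psi> f) = \<alpha> f"
    and f: "f \<in> sym_coalg L"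
  shows "\<psi> f = coder L k \<alpha> f"
proof
  interpret vector_space "scl L" by (rule vector_space)
  have app: "\<psi> f (u @ v) = \<psi> (\<lambda>u'. f (u' @ v)) u
     + (-1) ^ (k * wdeg L u) * \<psi> (\<lambda>v'. f (u @ v')) v" if "f \<in> sym_coalg L" for f u v
    using \<psi>(1) that
    by (fastforce simp: is_coderivation_def comult_def tensor_left_def tensor_right_def)
  have single: "\<psi> f [b] = representation (basis L) (\<alpha> f) b" if f: "f \<in> sym_coalg L" for f b
  proof -
    note g = \<psi>(2)[OF f]
    have "finite ((\<lambda>b. [b]) -` {w. \<psi> f w \<noteq> 0})"
      by (rule finite_vimageI) (use g in \<open>auto simp: sym_coalg_def inj_on_def\<close>)
    then have fin: "finite {b. \<psi> f [b] \<noteq> 0}" by (simp add: vimage_def)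
    have "representation (basis L) (\<alpha> f) = (\<lambda>b. \<psi> f [b])"
      by (rule representation_eqI)
        (use independent_basis span_basis fin g tau[OF f] in \<open>auto simp: sym_coalg_def tau_def\<close>)
    then show ?thesis by simp
  qed
  show "\<psi> f w = coder L k \<alpha> f w" for w
    using f
  proof (induction w arbitrary: f)
    case Nil
    have "\<psi> f [] = \<psi> f [] + \<psi> f []"
      using app[OF Nil, of "[]" "[]"] by (simp add: wdeg_def)
    then show ?case by (simp add: coder_def)
  next
    case (Cons b w)
    have *: "(\<lambda>u'. f (u' @ w)) \<in> sym_coalg L" "(\<lambda>v'. f ([b] @ v')) \<in> sym_coalg L"
      using slice_sym_coalg[OF Cons.prems, of "[]" w] slice_sym_coalg[OF Cons.prems, of "[b]" "[]"]
      by simp_all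
    show ?case
      using app[OF Cons.prems, of "[b]" w] coder_append[of L k \<alpha> f "[b]" w]
        single[OF *(1)] Cons.IH[OF *(2)]
      by (simp add: coder_def[of L k \<alpha> _ "[b]"] wdeg_def)
  qed
qed


section \<open>The CCE coalgebra\<close>

text \<open>
  The differential of \<open>sL\<close> follows the convention \<open>d s = - s d\<close>; this is the sign in
  \<open>cce_d\<close>. The maps \<open>\<tau>\<close>, \<open>d\<close> and \<open>\<partial>\<close> all have degree \<open>-1\<close>.
\<close>

definition cce_d :: "('k::field_char_0, 'a::ab_group_add) dgl \<Rightarrow> ('a list \<Rightarrow> 'k) \<Rightarrow> 'a list \<Rightarrow> 'k"
  where "cce_d L = coder L 1 (\<lambda>f. - dif L (tau L f))"

definition cce_partial :: "('k::field_char_0, 'a::ab_group_add) dgl \<Rightarrow> ('a list \<Rightarrow> 'k) \<Rightarrow> 'a list \<Rightarrow> 'k"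
  where "cce_partial L = coder L 1 (\<lambda>f. scl L (1/2) (cup_bracket L (tau L) 1 (tau L) f))"

definition cce_diff :: "('k::field_char_0, 'a::ab_group_add) dgl \<Rightarrow> ('a list \<Rightarrow> 'k) \<Rightarrow> 'a list \<Rightarrow> 'k"
  where "cce_diff L f = (\<lambda>w. cce_d L f w + cce_partial L f w)"

text \<open>The action of an element \<open>x\<close> of degree 0, induced by its adjoint action on \<open>L\<close>.\<close>

definition cce_act :: "('k::field_char_0, 'a::ab_group_add) dgl \<Rightarrow> 'a \<Rightarrow> ('a list \<Rightarrow> 'k) \<Rightarrow> 'a list \<Rightarrow> 'k"
  where "cce_act L x = coder L 0 (\<lambda>f. brk L x (tau L f))"


section \<open>The Weil coalgebra\<close>

text \<open>
  The set \<open>B\<close> is a basis of the Lie algebra; it only serves to write down the tensor coalgebra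
  in coordinates.
\<close>

definition weil_coalg :: "('k::field_char_0 \<Rightarrow> 'g::ab_group_add \<Rightarrow> 'g) \<Rightarrow> ('g \<Rightarrow> 'g \<Rightarrow> 'g) \<Rightarrow> 'g set
    \<Rightarrow> (('g \<times> 'g) list \<Rightarrow> 'k) set"
  where "weil_coalg scale bracket B = sym_coalg (cone scale bracket B)"

definition weil_hom :: "('k::field_char_0 \<Rightarrow> 'g::ab_group_add \<Rightarrow> 'g) \<Rightarrow> ('g \<Rightarrow> 'g \<Rightarrow> 'g) \<Rightarrow> 'g set
    \<Rightarrow> nat \<Rightarrow> (('g \<times> 'g) list \<Rightarrow> 'k) set"
  where "weil_hom scale bracket B n = sym_coalg_hom (cone scale bracket B) n"

definition weil_diff :: "('k::field_char_0 \<Rightarrow> 'g::ab_group_add \<Rightarrow> 'g) \<Rightarrow> ('g \<Rightarrow> 'g \<Rightarrow> 'g) \<Rightarrow> 'g set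
    \<Rightarrow> (('g \<times> 'g) list \<Rightarrow> 'k) \<Rightarrow> ('g \<times> 'g) list \<Rightarrow> 'k"
  where "weil_diff scale bracket B = cce_diff (cone scale bracket B)"

definition weil_act :: "('k::field_char_0 \<Rightarrow> 'g::ab_group_add \<Rightarrow> 'g) \<Rightarrow> ('g \<Rightarrow> 'g \<Rightarrow> 'g) \<Rightarrow> 'g set
    \<Rightarrow> 'g \<Rightarrow> (('g \<times> 'g) list \<Rightarrow> 'k) \<Rightarrow> ('g \<times> 'g) list \<Rightarrow> 'k"
  where "weil_act scale bracket B Y = cce_act (cone scale bracket B) (Y, 0)"

definition equivariant_contracting_homotopy ::
  "('k::field_char_0 \<Rightarrow> 'g::ab_group_add \<Rightarrow> 'g) \<Rightarrow> ('g \<Rightarrow> 'g \<Rightarrow> 'g) \<Rightarrow> 'g set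
    \<Rightarrow> ((('g \<times> 'g) list \<Rightarrow> 'k) \<Rightarrow> ('g \<times> 'g) list \<Rightarrow> 'k) \<Rightarrow> bool"
  where "equivariant_contracting_homotopy scale bracket B h \<longleftrightarrow>
    (let W = weil_coalg scale bracket B; D = weil_diff scale bracket B in
      (\<forall>f\<in>W. h f \<in> W) \<and>
      (\<forall>f\<in>W. \<forall>g\<in>W. h (\<lambda>w. f w + g w) = (\<lambda>w. h f w + h g w)) \<and>
      (\<forall>r. \<forall>f\<in>W. h (\<lambda>w. r * f w) = (\<lambda>w. r * h f w)) \<and>
      (\<forall>n. \<forall>f \<in> weil_hom scale bracket B n. h f \<in> weil_hom scale bracket B (n + 1)) \<and>
      (\<forall>Y. \<forall>f\<in>W. h (weil_act scale bracket B Y f) = weil_act scale bracket B Y (h f)) \<and>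
      (\<forall>f\<in>W. \<forall>w. D (h f) w + h (D f) w = f w - coaug (counit f) w))"

end

theory Submission
  imports Defs "HOL-Library.Function_Algebras"
begin

text \<open>
  Write the differential as \<open>D = d + \<partial>\<close>, and let \<open>s\<close> be the coderivation induced by
  \<open>Y + sZ \<mapsto> - sY\<close>. As \<open>ds + sd\<close> is the coderivation induced by the identity, it multiplies words
  of length \<open>n\<close> by \<open>n\<close>, so in characteristic zero \<open>h = s/n\<close> is an equivariant contraction for
  \<open>d\<close>. Then \<open>Dh + hD = Id - \<eta>\<epsilon> - T\<close> with \<open>T = - (\<partial>h + h\<partial>)\<close>, which lowers the word length, and
  \<open>T\<close> commutes with \<open>D\<close> because \<open>D\<^sup>2 = 0\<close>. Hence \<open>\<Sum>h T\<^sup>i\<close> is a finite sum on each element and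
  an equivariant contraction for \<open>D\<close>.
\<close>

section \<open>Linear maps on the tensor coalgebra\<close>

text \<open>The obstacle is that \<open>D^2 = 0\<close> holds only on symmetric elements, while a
  single word is usually not symmetric, so inside \<open>sym_coalg\<close> linear identities cannot
  be tested on words. The maps are therefore studied on the larger tensor coalgebra, where words
  form a basis. Symmetry enters where the maps are shown to preserve it, and where it lets the
  Jacobi identity kill the cubic part of \<open>D^2\<close>. Identities between \<open>d\<close>,
  \<open>D\<close>, \<open>s\<close> and the action reduce to components with values in
  \<open>L\<close>, because a graded commutator of coderivations is again a coderivation. Division
  by the length destroys the coderivation property of \<open>h\<close>, but it commutes with every
  coderivation induced by a linear map of \<open>L\<close>, in particular with \<open>d\<close> and
  with the action. Equivariance comes from \<open>[Y, sZ] = s[Y, Z]\<close> in the cone: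
  \<open>s\<close> commutes with the adjoint action, hence so does every map that enters the
  series.\<close>

definition tensor_coalg :: "('k::field_char_0, 'a) dgl \<Rightarrow> ('a list \<Rightarrow> 'k) set"
  where "tensor_coalg L = {f. finite {w. f w \<noteq> 0} \<and> (\<forall>w. f w \<noteq> 0 \<longrightarrow> set w \<subseteq> basis L)}"

text \<open>Linearity is asked only on families of finite support: a sum such as the one in
  \<open>tau\<close> is 0 by default when its index set is infinite, so such maps need not be
  additive on all functions.\<close>

definition coalg_linear :: "('k::field_char_0, 'a) dgl \<Rightarrow> ('k \<Rightarrow> 'b \<Rightarrow> 'b)
    \<Rightarrow> (('a list \<Rightarrow> 'k) \<Rightarrow> 'b::ab_group_add) \<Rightarrow> bool"
  where "coalg_linear L s l \<longleftrightarrow>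
    (\<forall>f\<in>tensor_coalg L. \<forall>g\<in>tensor_coalg L. l (\<lambda>w. f w + g w) = l f + l g) \<and>
    (\<forall>r. \<forall>f\<in>tensor_coalg L. l (\<lambda>w. r * f w) = s r (l f))"

lemma tensor_coalgI:
  assumes "finite S" "\<And>w. f w \<noteq> 0 \<Longrightarrow> w \<in> S" "\<And>w. f w \<noteq> 0 \<Longrightarrow> set w \<subseteq> basis L"
  shows "f \<in> tensor_coalg L"
  using assms by (auto simp: tensor_coalg_def intro: finite_subset[of _ S])

lemma sym_coalg_subset: "sym_coalg L \<subseteq> tensor_coalg L"
  by (auto simp: sym_coalg_def tensor_coalg_def)

lemma tensor_coalg_restrict:
  assumes "f \<in> tensor_coalg L" "\<And>w. g w \<noteq> 0 \<Longrightarrow> f w \<noteq> 0"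
  shows "g \<in> tensor_coalg L"
  using assms by (intro tensor_coalgI[of "{w. f w \<noteq> 0}"]) (auto simp: tensor_coalg_def)

lemma tensor_coalg_add:
  assumes "f \<in> tensor_coalg L" "g \<in> tensor_coalg L"
  shows "(\<lambda>w. f w + g w) \<in> tensor_coalg L"
proof (rule tensor_coalgI)
  show "finite ({w. f w \<noteq> 0} \<union> {w. g w \<noteq> 0})"
    using assms by (simp add: tensor_coalg_def)
  show "w \<in> {w. f w \<noteq> 0} \<union> {w. g w \<noteq> 0}" and "set w \<subseteq> basis L" if "f w + g w \<noteq> 0" for w
  proof -
    from that have "f w \<noteq> 0 \<or> g w \<noteq> 0" by auto
    then show "w \<in> {w. f w \<noteq> 0} \<union> {w. g w \<noteq> 0}" "set w \<subseteq> basis L"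
      using assms unfolding tensor_coalg_def by blast+
  qed
qed

lemma tensor_coalg_scale: "f \<in> tensor_coalg L \<Longrightarrow> (\<lambda>w. r w * f w) \<in> tensor_coalg L"
  by (erule tensor_coalg_restrict) auto

lemma tensor_coalg_zero: "(\<lambda>w. 0) \<in> tensor_coalg L"
  by (simp add: tensor_coalg_def)

lemma tensor_coalg_word: "set m \<subseteq> basis L \<Longrightarrow> word m \<in> tensor_coalg L"
  by (rule tensor_coalgI[of "{m}"]) (auto simp: word_def split: if_splits)

lemma slice_tensor_coalg:
  assumes "f \<in> tensor_coalg L"
  shows "(\<lambda>m. f (u @ m @ v)) \<in> tensor_coalg L"
proof (rule tensor_coalgI)
  show "finite ((\<lambda>m. u @ m @ v) -` {w. f w \<noteq> 0})"
    using assms by (intro finite_vimageI) (auto simp: tensor_coalg_def inj_on_def)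
  show "m \<in> (\<lambda>m. u @ m @ v) -` {w. f w \<noteq> 0}" if "f (u @ m @ v) \<noteq> 0" for m
    using that by simp
  show "set m \<subseteq> basis L" if "f (u @ m @ v) \<noteq> 0" for m
  proof -
    have "set (u @ m @ v) \<subseteq> basis L"
      using assms that unfolding tensor_coalg_def by blast
    then show ?thesis by simp
  qed
qed

lemma slice_tensor_coalg_simps:
  assumes "f \<in> tensor_coalg L"
  shows "(\<lambda>m. f (m @ v)) \<in> tensor_coalg L" "(\<lambda>m. f (u @ m)) \<in> tensor_coalg L"
    "(\<lambda>m. f (b # m)) \<in> tensor_coalg L"
  using slice_tensor_coalg[OF assms, of "[]" v] slice_tensor_coalg[OF assms, of u "[]"]
    slice_tensor_coalg[OF assms, of "[b]" "[]"] by simp_all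

lemma coalg_linearD:
  assumes "coalg_linear L s l"
  shows "f \<in> tensor_coalg L \<Longrightarrow> g \<in> tensor_coalg L \<Longrightarrow> l (\<lambda>w. f w + g w) = l f + l g"
    "f \<in> tensor_coalg L \<Longrightarrow> l (\<lambda>w. r * f w) = s r (l f)"
  using assms unfolding coalg_linear_def by blast+

lemma coalg_linear_zero:
  assumes "coalg_linear L s l" "module s"
  shows "l (\<lambda>w. 0) = 0"
proof -
  have "l (\<lambda>w. 0) = s 0 (l (\<lambda>w. 0))"
    using coalg_linearD(2)[OF assms(1) tensor_coalg_zero, of 0] by simp
  then show ?thesis using module.scale_zero_left[OF assms(2)] by simp
qed

lemma coalg_linear_eq_sum:
  assumes l: "coalg_linear L s l" and s: "module s"
    and f: "f \<in> tensor_coalg L" and S: "finite S" "\<And>w. f w \<noteq> 0 \<Longrightarrow> w \<in> S"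
  shows "l f = (\<Sum>m\<in>S. s (f m) (l (word m)))"
  using S f
proof (induction S arbitrary: f rule: finite_induct)
  case empty
  then have "f = (\<lambda>w. 0)" by auto
  then show ?case using coalg_linear_zero[OF l s] by simp
next
  case (insert m S)
  define g where "g = (\<lambda>w. if w = m then 0 else f w)"
  have g: "g \<in> tensor_coalg L" using insert.prems(2)
    by (rule tensor_coalg_restrict) (auto simp: g_def split: if_splits)
  have "l g = (\<Sum>m\<in>S. s (g m) (l (word m)))"
    using g insert.prems by (intro insert.IH) (auto simp: g_def split: if_splits)
  also have "\<dots> = (\<Sum>m\<in>S. s (f m) (l (word m)))"
    using insert.hyps by (intro sum.cong) (auto simp: g_def)
  finally have 1: "l g = (\<Sum>m\<in>S. s (f m) (l (word m)))" .
  show ?case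
  \<comment> \<open>A word outside the support may contain letters outside the basis, where
    linearity of \<open>l\<close> says nothing; its term vanishes with its coefficient.\<close>
  proof (cases "f m = 0")
    case True
    then have "g = f" by (auto simp: g_def)
    then show ?thesis using 1 insert.hyps True module.scale_zero_left[OF s] by simp
  next
    case False
    then have wm: "word m \<in> tensor_coalg L"
      using insert.prems(2) by (intro tensor_coalg_word) (auto simp: tensor_coalg_def)
    have "f = (\<lambda>w. f m * word m w + g w)" by (auto simp: g_def word_def)
    then have "l f = s (f m) (l (word m)) + l g"
      using coalg_linearD(1)[OF l tensor_coalg_scale[OF wm] g, of "\<lambda>_. f m"]
        coalg_linearD(2)[OF l wm] by simp
    then show ?thesis using 1 insert.hyps by simp
  qed
qed

lemma coalg_linear_eqI:
  assumes "coalg_linear L s l" "coalg_linear L s l'" "module s" "f \<in> tensor_coalg L"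
    and "\<And>m. set m \<subseteq> basis L \<Longrightarrow> l (word m) = l' (word m)"
  shows "l f = l' f"
proof -
  have fin: "finite {w. f w \<noteq> 0}" "\<And>w. w \<in> {w. f w \<noteq> 0} \<Longrightarrow> set w \<subseteq> basis L"
    using assms(4) by (auto simp: tensor_coalg_def)
  show ?thesis
    unfolding coalg_linear_eq_sum[OF assms(1,3,4) fin(1), simplified]
      coalg_linear_eq_sum[OF assms(2,3,4) fin(1), simplified]
    by (intro sum.cong refl arg_cong[where f = "s _"] assms(5) fin(2))
qed

lemma module_field: "module ((*) :: 'k::field \<Rightarrow> 'k \<Rightarrow> 'k)"
  by unfold_locales (auto simp: algebra_simps)

text \<open>Deconcatenation makes \<open>f\<close> a family on pairs of words, and \<open>l\<close>
  and \<open>l'\<close> act on separate factors. With finite support this is an exchange of two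
  finite sums; Koszul signs are added separately.\<close>

lemma coalg_linear_fubini:
  assumes l: "coalg_linear L (*) l" and l': "coalg_linear L (*) l'" and f: "f \<in> tensor_coalg L"
  shows "l (\<lambda>u. l' (\<lambda>v. f (u @ v))) = l' (\<lambda>v. l (\<lambda>u. f (u @ v)))"
    "(\<lambda>u. l' (\<lambda>v. f (u @ v))) \<in> tensor_coalg L"
    "(\<lambda>v. l (\<lambda>u. f (u @ v))) \<in> tensor_coalg L"
proof -
  \<comment> \<open>\<open>S\<close> and \<open>R\<close> collect the prefixes and the suffixes of
    the words in the support.\<close>
  define S where "S = (\<Union>w\<in>{w. f w \<noteq> 0}. (\<lambda>n. take n w) ` {..length w})"
  define R where "R = (\<Union>w\<in>{w. f w \<noteq> 0}. (\<lambda>n. drop n w) ` {..length w})"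
  have fin: "finite S" "finite R" using f by (auto simp: S_def R_def tensor_coalg_def)
  have S: "u \<in> S" and R: "v \<in> R" if "f (u @ v) \<noteq> 0" for u v
    unfolding S_def R_def
    by (rule UN_I[of "u @ v"], use that in simp, rule image_eqI[of _ _ "length u"], simp, simp)+
  have bas: "set u \<subseteq> basis L" "set v \<subseteq> basis L" if "f (u @ v) \<noteq> 0" for u v
  proof -
    have "set (u @ v) \<subseteq> basis L" using f that unfolding tensor_coalg_def by blast
    then show "set u \<subseteq> basis L" "set v \<subseteq> basis L" by auto
  qed
  have 1: "l' (\<lambda>v. f (u @ v)) = (\<Sum>v\<in>R. f (u @ v) * l' (word v))" for u
    using R by (intro coalg_linear_eq_sum[OF l' module_field slice_tensor_coalg_simps(2)[OF f] fin(2)])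
  have 2: "l (\<lambda>u. f (u @ v)) = (\<Sum>u\<in>S. f (u @ v) * l (word u))" for v
    using S by (intro coalg_linear_eq_sum[OF l module_field slice_tensor_coalg_simps(1)[OF f] fin(1)])
  have ex1: "\<exists>v. f (u @ v) \<noteq> 0" if "l' (\<lambda>v. f (u @ v)) \<noteq> 0" for u
    using that 1[of u] by (cases "\<exists>v. f (u @ v) \<noteq> 0") simp_all
  have ex2: "\<exists>u. f (u @ v) \<noteq> 0" if "l (\<lambda>u. f (u @ v)) \<noteq> 0" for v
    using that 2[of v] by (cases "\<exists>u. f (u @ v) \<noteq> 0") simp_all
  show t1: "(\<lambda>u. l' (\<lambda>v. f (u @ v))) \<in> tensor_coalg L"
    using fin(1) by (rule tensor_coalgI) (use ex1 S bas in blast)+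
  show t2: "(\<lambda>v. l (\<lambda>u. f (u @ v))) \<in> tensor_coalg L"
    using fin(2) by (rule tensor_coalgI) (use ex2 R bas in blast)+
  have "l (\<lambda>u. l' (\<lambda>v. f (u @ v))) = (\<Sum>u\<in>S. l' (\<lambda>v. f (u @ v)) * l (word u))"
    using ex1 S by (intro coalg_linear_eq_sum[OF l module_field t1 fin(1)]) blast
  also have "\<dots> = (\<Sum>v\<in>R. l (\<lambda>u. f (u @ v)) * l' (word v))"
    unfolding 1 2 sum_distrib_right by (subst sum.swap) (simp add: mult_ac)
  also have "\<dots> = l' (\<lambda>v. l (\<lambda>u. f (u @ v)))"
    using ex2 R by (intro coalg_linear_eq_sum[OF l' module_field t2 fin(2), symmetric]) blast
  finally show "l (\<lambda>u. l' (\<lambda>v. f (u @ v))) = l' (\<lambda>v. l (\<lambda>u. f (u @ v)))" .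
qed

section \<open>Coderivations\<close>

lemma wdeg_simps [simp]: "wdeg L [] = 0" "wdeg L (b # w) = deg L b + 1 + wdeg L w"
  "wdeg L (u @ v) = wdeg L u + wdeg L v"
  by (simp_all add: wdeg_def)

text \<open>
  The shift of the weight \<open>\<omega>\<close> is split into \<open>p\<close> and \<open>q\<close> to avoid subtraction; for
  \<open>\<omega> = wdeg\<close> the parity of the degree is that of \<open>p + q\<close>.
\<close>

definition homogeneous :: "('k::field_char_0, 'a::ab_group_add) dgl \<Rightarrow> ('a \<Rightarrow> nat) \<Rightarrow> nat \<Rightarrow> nat
    \<Rightarrow> (('a list \<Rightarrow> 'k) \<Rightarrow> 'a) \<Rightarrow> bool"
  where "homogeneous L \<omega> p q \<alpha> \<longleftrightarrow> (\<forall>m x. set m \<subseteq> basis L \<longrightarrow>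
    module.representation (scl L) (basis L) (\<alpha> (word m)) x \<noteq> 0 \<longrightarrow>
      sum_list (map \<omega> m) + p = \<omega> x + q)"

context dg_lie_algebra
begin

sublocale V: vector_space "scl L" by (rule vector_space)

abbreviation rep :: "'a \<Rightarrow> 'a \<Rightarrow> 'k"
  where "rep \<equiv> V.representation (basis L)"

lemma rep_simps [simp]:
  "rep 0 x = 0"
  "rep (y + z) x = rep y x + rep z x"
  "rep (- y) x = - rep y x"
  "rep (scl L r y) x = r * rep y x"
  using V.representation_add[of "basis L" z y] V.representation_scale[of "basis L" y r]
    V.representation_neg[of "basis L" y] V.representation_zero[of "basis L"]
    independent_basis span_basis by simp_all

lemma rep_ne_zero: "rep y x \<noteq> 0 \<Longrightarrow> x \<in> basis L"
  by (rule V.representation_ne_zero)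

lemma rep_basis: "b \<in> basis L \<Longrightarrow> rep b x = (if x = b then 1 else 0)"
  using V.representation_basis[OF _ , of "basis L" b] independent_basis by simp

lemma finite_rep: "finite {x. rep y x \<noteq> 0}"
  by (rule V.finite_representation)

lemma coalg_linear_rep:
  assumes "coalg_linear L (scl L) \<alpha>" shows "coalg_linear L (*) (\<lambda>f. rep (\<alpha> f) x)"
  using assms by (simp add: coalg_linear_def)

lemma module_scl: "module (scl L)"
  by (rule V.module_axioms)

lemma homogeneous_support:
  assumes "coalg_linear L (scl L) \<alpha>" "homogeneous L \<omega> p q \<alpha>"
    and f: "f \<in> tensor_coalg L" and nz: "rep (\<alpha> f) x \<noteq> 0"
  shows "\<exists>m. f m \<noteq> 0 \<and> sum_list (map \<omega> m) + p = \<omega> x + q"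
proof -
  have fin: "finite {w. f w \<noteq> 0}" using f by (simp add: tensor_coalg_def)
  have "rep (\<alpha> f) x = (\<Sum>m | f m \<noteq> 0. f m * rep (\<alpha> (word m)) x)"
    by (rule coalg_linear_eq_sum[OF coalg_linear_rep[OF assms(1)] module_field f fin]) simp
  with nz have "(\<Sum>m | f m \<noteq> 0. f m * rep (\<alpha> (word m)) x) \<noteq> 0" by simp
  then obtain m where "f m * rep (\<alpha> (word m)) x \<noteq> 0"
    by (rule sum.not_neutral_contains_not_neutral)
  then have "f m \<noteq> 0" "rep (\<alpha> (word m)) x \<noteq> 0" by simp_all
  with assms(2) f show ?thesis by (auto simp: homogeneous_def tensor_coalg_def)
qed

lemma coder_simps:
  "coder L k \<alpha> f [] = 0" "coder L k \<alpha> f [x] = rep (\<alpha> f) x"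
  by (simp_all add: coder_def)

lemma coder_nonzeroE:
  assumes "coder L k \<alpha> f w \<noteq> 0"
  obtains u x v where "w = u @ [x] @ v" "rep (\<alpha> (\<lambda>m. f (u @ m @ v))) x \<noteq> 0"
proof -
  from assms obtain i where "i \<in> {..<length w}" "(-1) ^ (k * wdeg L (take i w)) *
    rep (\<alpha> (\<lambda>m. f (take i w @ m @ drop (Suc i) w))) (w ! i) \<noteq> 0"
    unfolding coder_def by (rule sum.not_neutral_contains_not_neutral)
  then have "i < length w" "rep (\<alpha> (\<lambda>m. f (take i w @ m @ drop (Suc i) w))) (w ! i) \<noteq> 0"
    by simp_all
  then show ?thesis
    using that[of "take i w" "w ! i" "drop (Suc i) w"] id_take_nth_drop[of i w] by simp
qed

text \<open>One letter \<open>x\<close> of \<open>w\<close> is the output of \<alpha> on some word;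
  the remaining letters contribute equally to both weights and cancel.\<close>

lemma coder_support:
  assumes "coalg_linear L (scl L) \<alpha>" "homogeneous L \<omega> p q \<alpha>"
    and f: "f \<in> tensor_coalg L" and nz: "coder L k \<alpha> f w \<noteq> 0"
  shows "\<exists>m. f m \<noteq> 0 \<and> sum_list (map \<omega> m) + p = sum_list (map \<omega> w) + q"
proof -
  from nz obtain u x v where *: "w = u @ [x] @ v" "rep (\<alpha> (\<lambda>m. f (u @ m @ v))) x \<noteq> 0"
    by (rule coder_nonzeroE)
  from homogeneous_support[OF assms(1,2) slice_tensor_coalg[OF f] *(2)]
  obtain m where "f (u @ m @ v) \<noteq> 0" "sum_list (map \<omega> m) + p = \<omega> x + q" by blast
  then show ?thesis by (intro exI[of _ "u @ m @ v"]) (simp add: *(1))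
qed

lemma coalg_linear_coder:
  assumes "coalg_linear L (scl L) \<alpha>"
  shows "coalg_linear L (*) (\<lambda>f. coder L k \<alpha> f w)"
  unfolding coalg_linear_def coder_def
  by (simp add: coalg_linearD[OF assms] slice_tensor_coalg sum.distrib sum_distrib_left
      distrib_left mult_ac)

lemma coder_linear:
  assumes "coalg_linear L (scl L) \<alpha>"
  shows "f \<in> tensor_coalg L \<Longrightarrow> g \<in> tensor_coalg L \<Longrightarrow>
      coder L k \<alpha> (\<lambda>w. f w + g w) = (\<lambda>w. coder L k \<alpha> f w + coder L k \<alpha> g w)"
    "f \<in> tensor_coalg L \<Longrightarrow> coder L k \<alpha> (\<lambda>w. r * f w) = (\<lambda>w. r * coder L k \<alpha> f w)"
    "coder L k \<alpha> (\<lambda>w. 0) = (\<lambda>w. 0)"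
  using coalg_linearD[OF coalg_linear_coder[OF assms]]
    coalg_linear_zero[OF coalg_linear_coder[OF assms] module_field] by blast+

lemma coder_tensor_coalg:
  assumes a: "coalg_linear L (scl L) \<alpha>" and f: "f \<in> tensor_coalg L"
  shows "coder L k \<alpha> f \<in> tensor_coalg L"
proof -
  define P where "P = (\<Union>w\<in>{w. f w \<noteq> 0}. (\<lambda>n. take n w) ` {..length w})"
  define R where "R = (\<Union>w\<in>{w. f w \<noteq> 0}. (\<lambda>n. drop n w) ` {..length w})"
  \<comment> \<open>A word of the image is a prefix and a suffix of words in the support around one
    new letter, for which there are finitely many choices because coordinates in \<open>L\<close>
    are finite.\<close>
  define S where "S = (\<Union>u\<in>P. \<Union>v\<in>R. (\<lambda>x. u @ [x] @ v) ` {x. rep (\<alpha> (\<lambda>m. f (u @ m @ v))) x \<noteq> 0})"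
  have "finite P" "finite R" using f by (auto simp: P_def R_def tensor_coalg_def)
  then have S: "finite S" by (auto simp: S_def intro!: finite_rep)
  have P: "u \<in> P" if "f (u @ m) \<noteq> 0" for u m
    unfolding P_def by (rule UN_I[of "u @ m"], use that in simp, rule image_eqI[of _ _ "length u"], simp, simp)
  have R: "u \<in> R" if "f (m @ u) \<noteq> 0" for u m
    unfolding R_def by (rule UN_I[of "m @ u"], use that in simp, rule image_eqI[of _ _ "length m"], simp, simp)
  have *: "w \<in> S \<and> set w \<subseteq> basis L" if nz: "coder L k \<alpha> f w \<noteq> 0" for w
  proof -
    from nz obtain u x v where *: "w = u @ [x] @ v" "rep (\<alpha> (\<lambda>m. f (u @ m @ v))) x \<noteq> 0"
      by (rule coder_nonzeroE)
    have "\<exists>m. f (u @ m @ v) \<noteq> 0"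
    proof (rule ccontr)
      assume "\<not> ?thesis"
      then show False using *(2) coalg_linear_zero[OF a module_scl] by simp
    qed
    then obtain m where m: "f (u @ m @ v) \<noteq> 0" by blast
    then have "set (u @ m @ v) \<subseteq> basis L" using f unfolding tensor_coalg_def by blast
    moreover have "u \<in> P" using P[of u "m @ v"] m by simp
    moreover have "v \<in> R" using R[of "u @ m" v] m by simp
    ultimately show ?thesis
      using * rep_ne_zero[OF *(2)] unfolding S_def by auto
  qed
  show ?thesis by (rule tensor_coalgI[OF S]) (use * in blast)+
qed

section \<open>Koszul signs and preservation of symmetry\<close>

lemma minus_one_power_parity: "even (a + b) \<Longrightarrow> (- 1 :: 'k) ^ a = (- 1) ^ b"
  by (cases "even a") auto

text \<open>As \<alpha> shifts the degree by a fixed amount, a sign depending on the input word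
  becomes one depending on the output letter. Only the parity of the shift matters, hence
  \<open>p + q\<close> instead of a difference.\<close>

lemma homogeneous_sign:
  assumes a: "coalg_linear L (scl L) \<alpha>" "homogeneous L (\<lambda>b. deg L b + 1) p q \<alpha>"
    and f: "f \<in> tensor_coalg L"
  shows "rep (\<alpha> (\<lambda>m. (-1) ^ (j * wdeg L m) * f m)) x
    = (-1) ^ (j * (deg L x + 1 + p + q)) * rep (\<alpha> f) x"
proof -
  have fin: "finite {w. f w \<noteq> 0}" using f by (simp add: tensor_coalg_def)
  have "rep (\<alpha> (\<lambda>m. (-1) ^ (j * wdeg L m) * f m)) x
      = (\<Sum>m | f m \<noteq> 0. ((-1) ^ (j * wdeg L m) * f m) * rep (\<alpha> (word m)) x)"
    by (rule coalg_linear_eq_sum[OF coalg_linear_rep[OF a(1)] module_field tensor_coalg_scale[OF f] fin])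
      simp
  also have "\<dots> = (\<Sum>m | f m \<noteq> 0. (-1) ^ (j * (deg L x + 1 + p + q)) * (f m * rep (\<alpha> (word m)) x))"
  proof (rule sum.cong[OF refl])
    fix m assume "m \<in> {m. f m \<noteq> 0}"
    then have m: "set m \<subseteq> basis L" using f by (auto simp: tensor_coalg_def)
    show "((-1) ^ (j * wdeg L m) * f m) * rep (\<alpha> (word m)) x
      = (-1) ^ (j * (deg L x + 1 + p + q)) * (f m * rep (\<alpha> (word m)) x)"
    proof (cases "rep (\<alpha> (word m)) x = 0")
      case False
      with a(2) m have "wdeg L m + p = deg L x + 1 + q"
        unfolding homogeneous_def wdeg_def by blast
      then have "even (wdeg L m + (deg L x + 1 + p + q))" by presburger
      then have "even (j * wdeg L m + j * (deg L x + 1 + p + q))"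
        unfolding distrib_left[symmetric] by (rule dvd_mult)
      then show ?thesis by (simp only: minus_one_power_parity mult.assoc)
    qed simp
  qed
  also have "\<dots> = (-1) ^ (j * (deg L x + 1 + p + q)) * (\<Sum>m | f m \<noteq> 0. f m * rep (\<alpha> (word m)) x)"
    by (simp only: sum_distrib_left)
  also have "(\<Sum>m | f m \<noteq> 0. f m * rep (\<alpha> (word m)) x) = rep (\<alpha> f) x"
    by (rule coalg_linear_eq_sum[OF coalg_linear_rep[OF a(1)] module_field f fin, symmetric]) simp
  finally show ?thesis .
qed

lemma coder_sign:
  assumes a: "coalg_linear L (scl L) \<alpha>" "homogeneous L (\<lambda>b. deg L b + 1) p q \<alpha>"
    and f: "f \<in> tensor_coalg L"
  shows "coder L k \<alpha> (\<lambda>m. (-1) ^ (j * wdeg L m) * f m) w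
    = (-1) ^ (j * (wdeg L w + p + q)) * coder L k \<alpha> f w"
  unfolding coder_def sum_distrib_left
proof (rule sum.cong[OF refl])
  fix i assume "i \<in> {..<length w}"
  then have "w = take i w @ w ! i # drop (Suc i) w" using id_take_nth_drop[of i w] by simp
  then have w: "wdeg L w = wdeg L (take i w) + (deg L (w ! i) + 1 + wdeg L (drop (Suc i) w))"
    by (metis wdeg_simps(2,3))
  let ?e = "(-1) ^ (j * (wdeg L (take i w) + wdeg L (drop (Suc i) w))) :: 'k"
  let ?g = "\<lambda>m. f (take i w @ m @ drop (Suc i) w)"
  have g: "?g \<in> tensor_coalg L" by (rule slice_tensor_coalg[OF f])
  have "(\<lambda>m. (-1) ^ (j * wdeg L (take i w @ m @ drop (Suc i) w)) * ?g m)
      = (\<lambda>m. ?e * ((-1) ^ (j * wdeg L m) * ?g m))"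
    by (simp add: fun_eq_iff power_add distrib_left mult_ac)
  then have "rep (\<alpha> (\<lambda>m. (-1) ^ (j * wdeg L (take i w @ m @ drop (Suc i) w)) * ?g m)) (w ! i)
      = ?e * ((-1) ^ (j * (deg L (w ! i) + 1 + p + q)) * rep (\<alpha> ?g) (w ! i))"
    using coalg_linearD(2)[OF a(1) tensor_coalg_scale[OF g]] homogeneous_sign[OF a g] by simp
  also have "\<dots> = (-1) ^ (j * (wdeg L w + p + q)) * rep (\<alpha> ?g) (w ! i)"
    unfolding w by (simp add: power_add distrib_left mult_ac)
  finally show "(-1) ^ (k * wdeg L (take i w)) *
      rep (\<alpha> (\<lambda>m. (-1) ^ (j * wdeg L (take i w @ m @ drop (Suc i) w)) * ?g m)) (w ! i)
    = (-1) ^ (j * (wdeg L w + p + q)) * ((-1) ^ (k * wdeg L (take i w)) * rep (\<alpha> ?g) (w ! i))"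
    by (simp add: mult_ac)
qed

lemma sym_coalg_swap:
  assumes "f \<in> sym_coalg L"
  shows "f (u @ [x, y] @ v) = (-1) ^ ((deg L x + 1) * (deg L y + 1)) * f (u @ [y, x] @ v)"
  using assms unfolding sym_coalg_def by blast

lemma sym_coalg_move:
  assumes "f \<in> sym_coalg L"
  shows "f (u @ m @ [y]) = (-1) ^ ((deg L y + 1) * wdeg L m) * f (u @ y # m)"
proof (induction m arbitrary: u)
  case (Cons b m)
  have "f (u @ (b # m) @ [y]) = f ((u @ [b]) @ m @ [y])" by simp
  also have "\<dots> = (-1) ^ ((deg L y + 1) * wdeg L m) * f (u @ [b, y] @ m)"
    unfolding Cons.IH by simp
  also have "\<dots> = (-1) ^ ((deg L y + 1) * wdeg L (b # m)) * f (u @ y # b # m)"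
    using sym_coalg_swap[OF assms, of u b y m] by (simp add: power_add distrib_left mult_ac)
  finally show ?case by simp
qed simp

lemma sym_coalgI:
  assumes "f \<in> tensor_coalg L"
    and "\<And>u x y v. f (u @ [x, y] @ v) = (-1) ^ ((deg L x + 1) * (deg L y + 1)) * f (u @ [y, x] @ v)"
  shows "f \<in> sym_coalg L"
  using assms unfolding sym_coalg_def tensor_coalg_def by blast

text \<open>Where neither \<open>x\<close> nor \<open>y\<close> is the output of \<alpha>, the swap
  happens inside a slice of \<open>f\<close>. Where one of them is, the other must be moved past the
  word that \<alpha> contracts, and homogeneity turns the resulting sign into the one for a single
  letter. This forces the parity of the coderivation to be \<open>p + q\<close>.\<close>

lemma coder_sym_coalg:
  assumes a: "coalg_linear L (scl L) \<alpha>" "homogeneous L (\<lambda>b. deg L b + 1) p q \<alpha>"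
    and f: "f \<in> sym_coalg L"
  shows "coder L (p + q) \<alpha> f \<in> sym_coalg L"
proof (rule sym_coalgI)
  have ft: "f \<in> tensor_coalg L" using f sym_coalg_subset by blast
  show "coder L (p + q) \<alpha> f \<in> tensor_coalg L"
    by (rule coder_tensor_coalg[OF a(1) ft])
  fix u x y v
  let ?k = "p + q"
  let ?e = "(-1) ^ ((deg L x + 1) * (deg L y + 1)) :: 'k"
  define g where "g = (\<lambda>m. f (u @ m @ v))"
  have gs: "g \<in> sym_coalg L" unfolding g_def by (rule slice_sym_coalg[OF f])
  have gt: "g \<in> tensor_coalg L" using gs sym_coalg_subset by blast
  \<comment> \<open>In the first term \<open>y\<close> is carried to the front of the contracted
    word, so that both terms get the same form.\<close>
  have two: "coder L ?k \<alpha> g [x, y] = (-1) ^ ((deg L y + 1) * (deg L x + 1 + p + q)) * rep (\<alpha> (\<lambda>m. g (y # m))) x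
      + (-1) ^ (?k * (deg L x + 1)) * rep (\<alpha> (\<lambda>m. g (x # m))) y" for x y
  proof -
    have "coder L ?k \<alpha> g [x, y] = rep (\<alpha> (\<lambda>m. g (m @ [y]))) x
        + (-1) ^ (?k * (deg L x + 1)) * rep (\<alpha> (\<lambda>m. g (x # m))) y"
      using coder_append[of L ?k \<alpha> g "[x]" "[y]"] by (simp add: coder_simps)
    also have "(\<lambda>m. g (m @ [y])) = (\<lambda>m. (-1) ^ ((deg L y + 1) * wdeg L m) * g (y # m))"
      using sym_coalg_move[OF gs, of "[]"] by simp
    also have "rep (\<alpha> \<dots>) x = (-1) ^ ((deg L y + 1) * (deg L x + 1 + p + q)) * rep (\<alpha> (\<lambda>m. g (y # m))) x"
      by (rule homogeneous_sign[OF a slice_tensor_coalg_simps(3)[OF gt]])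
    finally show ?thesis .
  qed
  \<comment> \<open>Exchanging \<open>x\<close> and \<open>y\<close> interchanges the two terms;
    only the parities of the exponents remain to be compared.\<close>
  have mid: "coder L ?k \<alpha> g [x, y] = ?e * coder L ?k \<alpha> g [y, x]"
    unfolding two distrib_left mult.assoc[symmetric] power_add[symmetric]
    by (subst add.commute, rule arg_cong2[where f = "(+)"];
        rule arg_cong2[where f = "(*)", OF minus_one_power_parity refl])
      (auto simp: algebra_simps)
  have left: "coder L ?k \<alpha> (\<lambda>m. f (m @ [x, y] @ v)) u = ?e * coder L ?k \<alpha> (\<lambda>m. f (m @ [y, x] @ v)) u"
    unfolding sym_coalg_swap[OF f, of _ x y]
    using fun_cong[OF coder_linear(2)[OF a(1) slice_tensor_coalg_simps(1)[OF ft]]] by blast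
  have "(\<lambda>m. f (u @ [y, x] @ m)) \<in> tensor_coalg L"
    using slice_tensor_coalg[OF ft, of "u @ [y, x]" "[]"] by simp
  then have right: "coder L ?k \<alpha> (\<lambda>m. f (u @ [x, y] @ m)) v = ?e * coder L ?k \<alpha> (\<lambda>m. f (u @ [y, x] @ m)) v"
    unfolding sym_coalg_swap[OF f, of _ x y]
    by (rule fun_cong[OF coder_linear(2)[OF a(1)]])
  have split: "coder L ?k \<alpha> f (u @ [x, y] @ v) = coder L ?k \<alpha> (\<lambda>m. f (m @ [x, y] @ v)) u
     + (-1) ^ (?k * wdeg L u) * (coder L ?k \<alpha> g [x, y]
       + (-1) ^ (?k * wdeg L [x, y]) * coder L ?k \<alpha> (\<lambda>m. f (u @ [x, y] @ m)) v)" for x y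
    using coder_append[of L ?k \<alpha> f u "[x, y] @ v"]
      coder_append[of L ?k \<alpha> "\<lambda>m. f (u @ m)" "[x, y]" v]
    by (simp add: g_def)
  show "coder L ?k \<alpha> f (u @ [x, y] @ v) = ?e * coder L ?k \<alpha> f (u @ [y, x] @ v)"
    unfolding split mid left right by (simp add: algebra_simps)
qed

text \<open>The last two terms, with one map on each factor, are those that a graded commutator
  cancels: they reappear in the opposite composite up to the factor \<open>(-1) ^ (k * l)\<close>.
  The exponent \<open>k * l\<close> arises when the sign of the inner map is pulled out of the outer
  one by \<open>coder_sign\<close>.\<close>

lemma coder_coder_append:
  assumes a: "coalg_linear L (scl L) \<alpha>" "homogeneous L (\<lambda>b. deg L b + 1) p q \<alpha>"
    and b: "coalg_linear L (scl L) \<beta>" "homogeneous L (\<lambda>b. deg L b + 1) p' q' \<beta>"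
    and f: "f \<in> tensor_coalg L" and k: "k = p + q" and l: "l = p' + q'"
  defines "\<psi> \<equiv> coder L k \<alpha>" and "\<phi> \<equiv> coder L l \<beta>"
  shows "\<psi> (\<phi> f) (u @ v) =
    \<psi> (\<phi> (\<lambda>m. f (m @ v))) u + (-1) ^ ((k + l) * wdeg L u) * \<psi> (\<phi> (\<lambda>m. f (u @ m))) v
    + (-1) ^ (k * l + l * wdeg L u) * \<psi> (\<lambda>m. \<phi> (\<lambda>n. f (m @ n)) v) u
    + (-1) ^ (k * wdeg L u) * \<phi> (\<lambda>m. \<psi> (\<lambda>n. f (m @ n)) v) u"
proof -
  note la = coalg_linear_coder[OF a(1), of k, folded \<psi>_def]
  note lb = coalg_linear_coder[OF b(1), of l, folded \<phi>_def]
  note F = coalg_linear_fubini[OF lb la f]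
  note F' = coalg_linear_fubini[OF la lb f]
  have t: "\<phi> f \<in> tensor_coalg L" if "f \<in> tensor_coalg L" for f
    unfolding \<phi>_def by (rule coder_tensor_coalg[OF b(1) that])
  have app: "\<psi> f (u @ v) = \<psi> (\<lambda>m. f (m @ v)) u + (-1) ^ (k * wdeg L u) * \<psi> (\<lambda>m. f (u @ m)) v"
    for f u v unfolding \<psi>_def by (rule coder_append)
  have app': "\<phi> f (u @ v) = \<phi> (\<lambda>m. f (m @ v)) u + (-1) ^ (l * wdeg L u) * \<phi> (\<lambda>m. f (u @ m)) v"
    for f u v unfolding \<phi>_def by (rule coder_append)
  have 1: "\<psi> (\<lambda>m. \<phi> f (m @ v)) u = \<psi> (\<phi> (\<lambda>m. f (m @ v))) u
      + (-1) ^ (k * l + l * wdeg L u) * \<psi> (\<lambda>m. \<phi> (\<lambda>n. f (m @ n)) v) u"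
    unfolding app' coalg_linearD(1)[OF la t[OF slice_tensor_coalg_simps(1)[OF f]]
        tensor_coalg_scale[OF F'(2)]]
    using coder_sign[OF a F'(2), of k l v u] unfolding \<psi>_def
    by (simp add: k power_add distrib_left mult_ac)
  have 2: "\<psi> (\<lambda>m. \<phi> f (u @ m)) v = \<phi> (\<lambda>m. \<psi> (\<lambda>n. f (m @ n)) v) u
      + (-1) ^ (l * wdeg L u) * \<psi> (\<phi> (\<lambda>m. f (u @ m))) v"
    unfolding app' F(1)
      coalg_linearD(1)[OF la F(3) tensor_coalg_scale[OF t[OF slice_tensor_coalg_simps(2)[OF f]]]]
      coalg_linearD(2)[OF la t[OF slice_tensor_coalg_simps(2)[OF f]]] ..
  show ?thesis
    unfolding app 1 2 by (simp add: power_add distrib_left distrib_right mult_ac)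
qed

text \<open>
  The graded commutator of two coderivations is a coderivation, hence determined by its values on
  one-letter words.
\<close>

lemma coder_commutatorI:
  assumes a: "coalg_linear L (scl L) \<alpha>" "homogeneous L (\<lambda>b. deg L b + 1) p q \<alpha>"
    and b: "coalg_linear L (scl L) \<beta>" "homogeneous L (\<lambda>b. deg L b + 1) p' q' \<beta>"
    and kl: "k = p + q" "l = p' + q'"
    and C: "C \<subseteq> tensor_coalg L" "\<And>f u v. f \<in> C \<Longrightarrow> (\<lambda>m. f (u @ m @ v)) \<in> C"
    and \<gamma>: "\<And>f x. f \<in> C \<Longrightarrow> rep (\<alpha> (coder L l \<beta> f)) x = (-1) ^ (k * l) * rep (\<beta> (coder L k \<alpha> f)) x + rep (\<gamma> f) x"
    and f: "f \<in> C"
  shows "coder L k \<alpha> (coder L l \<beta> f) w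
    = (-1) ^ (k * l) * coder L l \<beta> (coder L k \<alpha> f) w + coder L (k + l) \<gamma> f w"
  using f
proof (induction w arbitrary: f)
  case Nil
  show ?case by (simp add: coder_simps)
next
  case (Cons x w)
  have ft: "f \<in> tensor_coalg L" using C(1) Cons.prems by blast
  \<comment> \<open>\<open>C\<close> is closed under slices, so the same induction serves for the
    tensor coalgebra and for its symmetric part; the square of the differential requires the
    latter.\<close>
  have 1: "(\<lambda>m. f (m @ w)) \<in> C" "(\<lambda>m. f ([x] @ m)) \<in> C"
    using C(2)[OF Cons.prems, of "[]" w] C(2)[OF Cons.prems, of "[x]" "[]"] by simp_all
  have e: "((-1) ^ (l * k)) * ((-1) ^ (l * k) * z) = (z :: 'k)" for z
    by (simp add: mult.assoc[symmetric] power_add[symmetric])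
  note A = coder_coder_append[OF a b ft kl, of "[x]" w]
  note B = coder_coder_append[OF b a ft kl(2,1), of "[x]" w]
  note G = coder_append[of L "k + l" \<gamma> f "[x]" w]
  note H = \<gamma>[OF 1(1), of x]
  show ?case
    using A B G H Cons.IH[OF 1(2)]
    by (simp add: coder_simps algebra_simps power_add e)
qed

end

section \<open>The differential of the CCE coalgebra squares to zero\<close>

text \<open>For maps defined by a sum over the support of the argument: additivity is not evident
  there, because the support of a sum may be smaller than the union of the supports.\<close>

lemma coalg_linearI:
  assumes s: "module s"
    and l: "\<And>f. f \<in> tensor_coalg L \<Longrightarrow> l f = (\<Sum>m | f m \<noteq> 0. s (f m) (\<phi> m))"
  shows "coalg_linear L s l"
proof -
  interpret module s by fact
  have eq: "l f = (\<Sum>m\<in>S. s (f m) (\<phi> m))"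
    if "f \<in> tensor_coalg L" "finite S" "{m. f m \<noteq> 0} \<subseteq> S" for f S
    unfolding l[OF that(1)] using that(2,3) by (intro sum.mono_neutral_left) auto
  show ?thesis
    unfolding coalg_linear_def
  proof (intro conjI ballI allI)
    fix f g assume fg: "f \<in> tensor_coalg L" "g \<in> tensor_coalg L"
    let ?S = "{m. f m \<noteq> 0} \<union> {m. g m \<noteq> 0}"
    have S: "finite ?S" using fg by (simp add: tensor_coalg_def)
    have "{m. f m + g m \<noteq> 0} \<subseteq> ?S" by auto
    then show "l (\<lambda>w. f w + g w) = l f + l g"
      using eq[OF tensor_coalg_add[OF fg] S] eq[OF fg(1) S] eq[OF fg(2) S]
      by (simp add: scale_left_distrib sum.distrib)
  next
    fix r f assume f: "f \<in> tensor_coalg L"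
    let ?S = "{m. f m \<noteq> 0}"
    have S: "finite ?S" using f by (simp add: tensor_coalg_def)
    have "{m. r * f m \<noteq> 0} \<subseteq> ?S" by auto
    then show "l (\<lambda>w. r * f w) = s r (l f)"
      using eq[OF tensor_coalg_scale[OF f] S] eq[OF f S]
      by (simp add: scale_sum_right)
  qed
qed

lemma tau_cong: "(\<And>b. f [b] = g [b]) \<Longrightarrow> tau L f = tau L g"
  by (simp add: tau_def)

context dg_lie_algebra
begin

lemma brk_simps [simp]:
  "brk L (x + y) z = brk L x z + brk L y z" "brk L z (x + y) = brk L z x + brk L z y"
  "brk L (scl L r x) z = scl L r (brk L x z)" "brk L z (scl L r x) = scl L r (brk L z x)"
  "brk L 0 z = 0" "brk L z 0 = 0" "brk L (- x) z = - brk L x z" "brk L z (- x) = - brk L z x"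
proof -
  interpret l: Vector_Spaces.linear "scl L" "scl L" "\<lambda>x. brk L x z" for z by (rule linear_brk_left)
  interpret r: Vector_Spaces.linear "scl L" "scl L" "brk L z" for z by (rule linear_brk_right)
  show "brk L (x + y) z = brk L x z + brk L y z" "brk L z (x + y) = brk L z x + brk L z y"
    "brk L (scl L r x) z = scl L r (brk L x z)" "brk L z (scl L r x) = scl L r (brk L z x)"
    "brk L 0 z = 0" "brk L z 0 = 0" "brk L (- x) z = - brk L x z" "brk L z (- x) = - brk L z x"
    by (fact l.add r.add l.scale r.scale l.zero r.zero l.neg r.neg)+
qed

lemma brk_sum:
  "brk L (sum f A) z = (\<Sum>a\<in>A. brk L (f a) z)" "brk L z (sum f A) = (\<Sum>a\<in>A. brk L z (f a))"
  by (induction A rule: infinite_finite_induct; simp)+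

lemma dif_simps [simp]:
  "dif L (x + y) = dif L x + dif L y" "dif L (scl L r x) = scl L r (dif L x)"
  "dif L 0 = 0" "dif L (- x) = - dif L x"
proof -
  interpret d: Vector_Spaces.linear "scl L" "scl L" "dif L" by (rule linear_dif)
  show "dif L (x + y) = dif L x + dif L y" "dif L (scl L r x) = scl L r (dif L x)"
    "dif L 0 = 0" "dif L (- x) = - dif L x"
    by (fact d.add d.scale d.zero d.neg)+
qed

lemma basis_grade: "b \<in> basis L \<Longrightarrow> b \<in> grade L (deg L b)"
  by (auto simp: grade_def intro: V.span_base)

lemma grade_simps:
  "0 \<in> grade L n"
  "x \<in> grade L n \<Longrightarrow> - x \<in> grade L n" "x \<in> grade L n \<Longrightarrow> scl L r x \<in> grade L n"
  unfolding grade_def by (auto intro: V.span_zero V.span_neg V.span_scale)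

lemma grade_rep_nonzero:
  assumes "x \<in> grade L n" "rep x b \<noteq> 0" shows "deg L b = n"
proof -
  have "rep x = V.representation {b \<in> basis L. deg L b = n} x"
    using assms(1) independent_basis unfolding grade_def by (intro V.representation_extend) auto
  then show ?thesis using assms(2) V.representation_ne_zero by fastforce
qed

lemma rep_sum: "(\<Sum>b | rep x b \<noteq> 0. scl L (rep x b) b) = x"
  using V.sum_nonzero_representation_eq[of "basis L" x] independent_basis span_basis by simp

lemma rep_sum_superset:
  assumes "finite A" "{b. rep x b \<noteq> 0} \<subseteq> A"
  shows "(\<Sum>b\<in>A. scl L (rep x b) b) = x"
proof -
  have "(\<Sum>b | rep x b \<noteq> 0. scl L (rep x b) b) = (\<Sum>b\<in>A. scl L (rep x b) b)"
    using assms by (intro sum.mono_neutral_left) auto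
  then show ?thesis unfolding rep_sum ..
qed

section \<open>The desuspension and the cup bracket on words\<close>

lemma tau_word: "tau L (word [b]) = b" "length m \<noteq> 1 \<Longrightarrow> tau L (word m) = 0"
proof -
  have "{c. (word [b] [c] :: 'k) \<noteq> 0} = {b}" by (auto simp: word_def)
  then show "tau L (word [b]) = b" by (simp add: tau_def word_def)
  show "tau L (word m) = 0" if "length m \<noteq> 1"
    using that by (auto simp: tau_def word_def intro!: sum.neutral)
qed

lemma tau_word_simps [simp]: "tau L (word []) = 0" "tau L (word [b]) = b"
  "tau L (word (b # c # m)) = 0"
  by (simp_all add: tau_word)

lemma coalg_linear_tau: "coalg_linear L (scl L) (tau L)"
proof (rule coalg_linearI[OF module_scl])
  fix f assume f: "f \<in> tensor_coalg L"
  have fin: "finite {m. f m \<noteq> 0}" using f by (simp add: tensor_coalg_def)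
  have "(\<Sum>m | f m \<noteq> 0. scl L (f m) (tau L (word m)))
      = (\<Sum>m\<in>(\<lambda>b. [b]) ` {b. f [b] \<noteq> 0}. scl L (f m) (tau L (word m)))"
  proof (rule sum.mono_neutral_right[OF fin])
    show "\<forall>m\<in>{m. f m \<noteq> 0} - (\<lambda>b. [b]) ` {b. f [b] \<noteq> 0}. scl L (f m) (tau L (word m)) = 0"
    proof
      fix m assume "m \<in> {m. f m \<noteq> 0} - (\<lambda>b. [b]) ` {b. f [b] \<noteq> 0}"
      then have "length m \<noteq> 1" by (auto simp: length_Suc_conv)
      then show "scl L (f m) (tau L (word m)) = 0" by (simp add: tau_word(2))
    qed
  qed auto
  also have "\<dots> = tau L f"
    unfolding tau_def[of L f] by (simp add: sum.reindex inj_on_def)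
  finally show "tau L f = (\<Sum>m | f m \<noteq> 0. scl L (f m) (tau L (word m)))" ..
qed

abbreviation cup :: "('a list \<Rightarrow> 'k) \<Rightarrow> 'a"
  where "cup \<equiv> cup_bracket L (tau L) (Suc 0) (tau L)"

lemma finite_splittings: "finite {(u, v). u @ v = m}"
proof (rule finite_subset)
  show "{(u, v). u @ v = m} \<subseteq> (\<lambda>n. (take n m, drop n m)) ` {..length m}"
  proof
    fix p assume "p \<in> {(u, v). u @ v = m}"
    then show "p \<in> (\<lambda>n. (take n m, drop n m)) ` {..length m}"
      by (intro image_eqI[of _ _ "length (fst p)"]) auto
  qed
qed simp

lemma cup_word: "cup (word m) = (\<Sum>(u, v) | u @ v = m.
    scl L ((-1) ^ wdeg L u) (brk L (tau L (word u)) (tau L (word v))))"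
  unfolding cup_bracket_def by (intro sum.cong) (auto simp: comult_def word_def)

lemma coalg_linear_cup: "coalg_linear L (scl L) cup"
proof (rule coalg_linearI[OF module_scl])
  fix f assume f: "f \<in> tensor_coalg L"
  have fin: "finite {m. f m \<noteq> 0}" using f by (simp add: tensor_coalg_def)
  let ?t = "\<lambda>(u, v). scl L ((-1) ^ wdeg L u * f (u @ v)) (brk L (tau L (word u)) (tau L (word v)))"
  let ?I = "{(u, v). f (u @ v) \<noteq> 0}"
  have "?I = (\<Union>m\<in>{m. f m \<noteq> 0}. {(u, v). u @ v = m})" by auto
  then have finI: "finite ?I" using fin finite_splittings by auto
  have "cup f = sum ?t ?I"
    by (simp add: cup_bracket_def comult_def)
  also have "\<dots> = (\<Sum>m | f m \<noteq> 0. sum ?t {p \<in> ?I. (case p of (u, v) \<Rightarrow> u @ v) = m})"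
    by (rule sum.group[OF finI fin, symmetric]) auto
  also have "\<dots> = (\<Sum>m | f m \<noteq> 0. scl L (f m) (cup (word m)))"
  proof (rule sum.cong[OF refl])
    fix m assume "m \<in> {m. f m \<noteq> 0}"
    then show "sum ?t {p \<in> ?I. (case p of (u, v) \<Rightarrow> u @ v) = m} = scl L (f m) (cup (word m))"
      unfolding cup_word V.scale_sum_right by (intro sum.cong) (auto simp: mult.commute)
  qed
  finally show "cup f = (\<Sum>m | f m \<noteq> 0. scl L (f m) (cup (word m)))" .
qed

text \<open>\<open>tau\<close> lives on single letters, so only the splitting into one letter on
  each side contributes. The sign comes from moving the second, odd \<open>tau\<close> past the
  suspension of \<open>b\<close>.\<close>

lemma cup_word_simps:
  "cup (word [b, c]) = scl L ((-1) ^ (deg L b + 1)) (brk L b c)"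
  "length m \<noteq> 2 \<Longrightarrow> cup (word m) = 0"
proof -
  have "{(u, v). u @ v = [b, c]} = {([], [b, c]), ([b], [c]), ([b, c], [])}"
    by (auto simp: append_eq_Cons_conv)
  then show "cup (word [b, c]) = scl L ((-1) ^ (deg L b + 1)) (brk L b c)"
    by (simp add: cup_word)
  have "brk L (tau L (word u)) (tau L (word v)) = 0" if "length (u @ v) \<noteq> 2" for u v
  proof -
    from that have "length u \<noteq> 1 \<or> length v \<noteq> 1" by auto
    then show ?thesis using tau_word(2) by auto
  qed
  then show "cup (word m) = 0" if "length m \<noteq> 2"
    using that by (auto simp: cup_word intro!: sum.neutral)
qed

lemma cup_word_length [simp]:
  "cup (word []) = 0" "cup (word [b]) = 0" "cup (word (b # c # e # m)) = 0"
  by (simp_all add: cup_word_simps)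

lemma cup_eq_sum:
  assumes f: "f \<in> tensor_coalg L" and A: "finite A" "\<And>x y. f [x, y] \<noteq> 0 \<Longrightarrow> x \<in> A \<and> y \<in> A"
  shows "cup f = (\<Sum>x\<in>A. \<Sum>y\<in>A. scl L (f [x, y] * (-1) ^ (deg L x + 1)) (brk L x y))"
proof -
  let ?S = "(\<lambda>(x, y). [x, y]) ` (A \<times> A)"
  have fin: "finite {m. f m \<noteq> 0}" using f by (simp add: tensor_coalg_def)
  have "cup f = (\<Sum>m\<in>{m. f m \<noteq> 0} \<union> ?S. scl L (f m) (cup (word m)))"
    by (rule coalg_linear_eq_sum[OF coalg_linear_cup module_scl f]) (use fin A(1) in auto)
  also have "\<dots> = (\<Sum>m\<in>?S. scl L (f m) (cup (word m)))"
  proof (rule sum.mono_neutral_right)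
    show "finite ({m. f m \<noteq> 0} \<union> ?S)" using fin A(1) by simp
    show "\<forall>m\<in>{m. f m \<noteq> 0} \<union> ?S - ?S. scl L (f m) (cup (word m)) = 0"
    proof
      fix m assume m: "m \<in> {m. f m \<noteq> 0} \<union> ?S - ?S"
      have "length m \<noteq> 2"
      proof
        assume "length m = 2"
        then obtain x y where "m = [x, y]" by (auto simp: length_Suc_conv numeral_2_eq_2)
        with m A(2)[of x y] show False by auto
      qed
      then show "scl L (f m) (cup (word m)) = 0" by (simp add: cup_word_simps(2))
    qed
  qed simp
  also have "\<dots> = (\<Sum>(x, y)\<in>A \<times> A. scl L (f [x, y]) (cup (word [x, y])))"
    by (subst sum.reindex) (auto simp: inj_on_def case_prod_unfold)
  also have "\<dots> = (\<Sum>x\<in>A. \<Sum>y\<in>A. scl L (f [x, y] * (-1) ^ (deg L x + 1)) (brk L x y))"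
    by (simp only: sum.cartesian_product cup_word_simps(1) V.scale_scale)
  finally show ?thesis .
qed

text \<open>The cup bracket sees two-letter words only. Such a word arises from \<open>b # m\<close>
  in two ways: \<beta> contracts everything before the last letter \<open>e\<close>, or everything
  after the first letter \<open>b\<close>. Hence the description of the word from both ends.\<close>

lemma cup_coder_word:
  assumes \<beta>: "coalg_linear L (scl L) \<beta>" and m: "set (b # m) \<subseteq> basis L" "b # m = m' @ [e]"
    and n: "\<beta> (word m') \<in> grade L n"
  shows "cup (coder L k \<beta> (word (b # m))) = scl L ((-1) ^ (n + 1)) (brk L (\<beta> (word m')) e)
    + scl L ((-1) ^ ((k + 1) * (deg L b + 1))) (brk L b (\<beta> (word m)))"
proof -
  let ?z = "\<beta> (word m')" and ?z' = "\<beta> (word m)" and ?g = "coder L k \<beta> (word (b # m))"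
  define A where "A = {b, e} \<union> {x. rep ?z x \<noteq> 0} \<union> {x. rep ?z' x \<noteq> 0}"
  have A: "finite A" by (simp add: A_def finite_rep)
  have g: "?g \<in> tensor_coalg L"
    by (rule coder_tensor_coalg[OF \<beta> tensor_coalg_word[OF m(1)]])
  have 0: "\<beta> (\<lambda>w. 0) = 0" by (rule coalg_linear_zero[OF \<beta> module_scl])
  have 1: "\<beta> (\<lambda>w. word (b # m) (w @ [y])) = (if y = e then ?z else 0)" for y
  proof -
    have "(\<lambda>w. word (b # m) (w @ [y]) :: 'k) = (if y = e then word m' else (\<lambda>w. 0))"
      unfolding m(2) by (auto simp: word_def)
    then show ?thesis by (simp add: 0)
  qed
  have 2: "\<beta> (\<lambda>w. word (b # m) (x # w)) = (if x = b then ?z' else 0)" for x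
  proof -
    have "(\<lambda>w. word (b # m) (x # w) :: 'k) = (if x = b then word m else (\<lambda>w. 0))"
      by (auto simp: word_def)
    then show ?thesis by (simp add: 0)
  qed
  have gxy: "?g [x, y] = (if y = e then rep ?z x else 0)
      + (-1) ^ (k * (deg L x + 1)) * (if x = b then rep ?z' y else 0)" for x y
    using coder_append[of L k \<beta> "word (b # m)" "[x]" "[y]"] by (simp add: coder_simps 1 2)
  have "cup ?g = (\<Sum>x\<in>A. \<Sum>y\<in>A. scl L (?g [x, y] * (-1) ^ (deg L x + 1)) (brk L x y))"
    by (rule cup_eq_sum[OF g A]) (auto simp: gxy A_def split: if_splits)
  also have "\<dots> = (\<Sum>x\<in>A. \<Sum>y\<in>A. if y = e then scl L (rep ?z x * (-1) ^ (n + 1)) (brk L x e) else 0)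
      + (\<Sum>x\<in>A. \<Sum>y\<in>A. if x = b then
          scl L ((-1) ^ ((k + 1) * (deg L b + 1)) * rep ?z' y) (brk L b y) else 0)"
    unfolding sum.distrib[symmetric]
  proof (intro sum.cong refl)
    fix x y
    \<comment> \<open>The sign depends on the letter \<open>x\<close>, but all letters that occur in
      \<open>?z\<close> have the same degree \<open>n\<close>.\<close>
    have "rep ?z x * (-1) ^ (deg L x + 1) = rep ?z x * (-1) ^ (n + 1)"
      using grade_rep_nonzero[OF n, of x] by (cases "rep ?z x = 0") auto
    then show "scl L (?g [x, y] * (-1) ^ (deg L x + 1)) (brk L x y)
      = (if y = e then scl L (rep ?z x * (-1) ^ (n + 1)) (brk L x e) else 0)
      + (if x = b then scl L ((-1) ^ ((k + 1) * (deg L b + 1)) * rep ?z' y) (brk L b y) else 0)"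
      unfolding gxy distrib_right V.scale_left_distrib
      by (auto simp: power_add distrib_right mult_ac)
  qed
  also have "(\<Sum>x\<in>A. \<Sum>y\<in>A. if y = e then scl L (rep ?z x * (-1) ^ (n + 1)) (brk L x e) else 0)
      = (\<Sum>x\<in>A. scl L (rep ?z x * (-1) ^ (n + 1)) (brk L x e))"
    using A by (simp add: A_def)
  also have "\<dots> = scl L ((-1) ^ (n + 1)) (brk L (\<Sum>x\<in>A. scl L (rep ?z x) x) e)"
    unfolding brk_sum V.scale_sum_right brk_simps V.scale_scale by (simp only: mult.commute)
  also have "(\<Sum>x\<in>A. scl L (rep ?z x) x) = ?z"
    using A by (rule rep_sum_superset) (auto simp: A_def)
  also have "(\<Sum>x\<in>A. \<Sum>y\<in>A. if x = b then
          scl L ((-1) ^ ((k + 1) * (deg L b + 1)) * rep ?z' y) (brk L b y) else 0)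
      = (\<Sum>y\<in>A. scl L ((-1) ^ ((k + 1) * (deg L b + 1)) * rep ?z' y) (brk L b y))"
    using A by (subst sum.swap) (simp add: A_def)
  also have "\<dots> = scl L ((-1) ^ ((k + 1) * (deg L b + 1))) (brk L b (\<Sum>y\<in>A. scl L (rep ?z' y) y))"
    unfolding brk_sum V.scale_sum_right brk_simps V.scale_scale ..
  also have "(\<Sum>y\<in>A. scl L (rep ?z' y) y) = ?z'"
    using A by (rule rep_sum_superset) (auto simp: A_def)
  finally show ?thesis .
qed

text \<open>The composite of \<open>tau\<close> with the differential. Joining both parts in one
  component presents the differential as a single coderivation, so that its square takes one
  computation.\<close>

definition cce_component :: "('a list \<Rightarrow> 'k) \<Rightarrow> 'a"
  where "cce_component f = - dif L (tau L f) + scl L (1/2) (cup f)"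

lemma rep_diff [simp]: "rep (x - y) z = rep x z - rep y z"
  using rep_simps(2)[of x "- y" z] by simp

lemma cce_diff_eq: "cce_diff L = coder L 1 cce_component"
  by (simp add: fun_eq_iff cce_diff_def cce_d_def cce_partial_def coder_def cce_component_def
      sum.distrib[symmetric] right_diff_distrib)

lemma coalg_linear_compose:
  assumes "coalg_linear L (scl L) \<alpha>"
    and "\<And>x y. l (x + y) = l x + l y" "\<And>r x. l (scl L r x) = s r (l x)"
  shows "coalg_linear L s (\<lambda>f. l (\<alpha> f))"
  using assms by (simp add: coalg_linear_def)

lemma coalg_linear_sum:
  assumes "coalg_linear L (scl L) \<alpha>" "coalg_linear L (scl L) \<beta>"
  shows "coalg_linear L (scl L) (\<lambda>f. \<alpha> f + \<beta> f)"
  using assms by (simp add: coalg_linear_def V.scale_right_distrib)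

lemma coalg_linear_coder_comp:
  assumes "coalg_linear L s l" "coalg_linear L (scl L) \<beta>"
  shows "coalg_linear L s (\<lambda>f. l (coder L k \<beta> f))"
  unfolding coalg_linear_def
  by (simp add: coder_linear[OF assms(2)] coalg_linearD[OF assms(1)] coder_tensor_coalg[OF assms(2)])

lemma coalg_linear_partial_component: "coalg_linear L (scl L) (\<lambda>f. scl L (1/2) (cup f))"
  by (rule coalg_linear_compose[OF coalg_linear_cup])
    (simp_all add: V.scale_right_distrib V.scale_left_commute)

lemma coalg_linear_dif_component: "coalg_linear L (scl L) (\<lambda>f. - dif L (tau L f))"
  by (rule coalg_linear_compose[OF coalg_linear_tau]) simp_all

lemma coalg_linear_cce_component: "coalg_linear L (scl L) cce_component"
  unfolding cce_component_def
  by (intro coalg_linear_sum coalg_linear_dif_component coalg_linear_partial_component)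

text \<open>\<open>cce_component\<close> lives on words of one and two letters, so its composite
  with the differential can be nonzero on at most three letters; all longer words form one
  case.\<close>

lemma word_length_cases:
  obtains "m = []" | b where "m = [b]" | b c where "m = [b, c]" | b c e where "m = [b, c, e]"
    | b c e g n where "m = b # c # e # g # n"
  by (metis list.exhaust)

lemma rep_brk_basis:
  assumes "b \<in> basis L" "c \<in> basis L" "rep (brk L b c) x \<noteq> 0"
  shows "deg L x = deg L b + deg L c"
  using grade_rep_nonzero[OF brk_grade[OF basis_grade basis_grade]] assms by blast

lemma dif_deg_0: "b \<in> basis L \<Longrightarrow> deg L b = 0 \<Longrightarrow> dif L b = 0"
  using basis_grade[of b] dif_grade_0[of b] by simp

text \<open>In degree 0 the subtraction truncates, which is harmless because the differential
  vanishes there.\<close>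

lemma dif_basis_grade: "b \<in> basis L \<Longrightarrow> dif L b \<in> grade L (deg L b - 1)"
  using basis_grade[of b] dif_grade_Suc[of b "deg L b - 1"] dif_deg_0[of b]
  by (cases "deg L b") (simp_all add: grade_simps)

lemma rep_dif_basis:
  assumes "b \<in> basis L" "rep (dif L b) x \<noteq> 0" shows "deg L x + 1 = deg L b"
proof -
  have "deg L b \<noteq> 0"
  proof
    assume "deg L b = 0"
    then have "dif L b = 0" using assms(1) by (intro dif_deg_0)
    then show False using assms(2) by simp
  qed
  then show ?thesis using grade_rep_nonzero[OF dif_basis_grade assms(2)] assms(1) by simp
qed

lemma homogeneous_dif_component: "homogeneous L (\<lambda>b. deg L b + 1) 0 1 (\<lambda>f. - dif L (tau L f))"
  unfolding homogeneous_def
proof (intro allI impI)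
  fix m x assume "set m \<subseteq> basis L" "rep (- dif L (tau L (word m))) x \<noteq> 0"
  then show "(\<Sum>b\<leftarrow>m. deg L b + 1) + 0 = deg L x + 1 + 1"
    by (cases m rule: word_length_cases) (auto dest: rep_dif_basis)
qed

text \<open>The constant weight counts letters: the bracket contracts two into one. This is what
  will make the perturbation term lower the word length.\<close>

lemma homogeneous_partial_component:
  "homogeneous L (\<lambda>b. deg L b + 1) 0 1 (\<lambda>f. scl L (1/2) (cup f))"
  "homogeneous L (\<lambda>b. 1) 0 1 (\<lambda>f. scl L (1/2) (cup f))"
  unfolding homogeneous_def atomize_conj
proof (intro conjI allI impI)
  fix m x assume *: "set m \<subseteq> basis L" "rep (scl L (1/2) (cup (word m))) x \<noteq> 0"
  then show "(\<Sum>b\<leftarrow>m. deg L b + 1) + 0 = deg L x + 1 + 1"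
    by (cases m rule: word_length_cases) (auto simp: cup_word_simps dest: rep_brk_basis)
  show "(\<Sum>b\<leftarrow>m. 1) + 0 = 1 + (1::nat)"
    using * by (cases m rule: word_length_cases) (auto simp: cup_word_simps dest: rep_brk_basis)
qed

lemma homogeneous_sum:
  assumes "homogeneous L \<omega> p q \<alpha>" "homogeneous L \<omega> p q \<beta>"
  shows "homogeneous L \<omega> p q (\<lambda>f. \<alpha> f + \<beta> f)"
  unfolding homogeneous_def
proof (intro allI impI)
  fix m x assume *: "set m \<subseteq> basis L" "rep (\<alpha> (word m) + \<beta> (word m)) x \<noteq> 0"
  then have "rep (\<alpha> (word m)) x \<noteq> 0 \<or> rep (\<beta> (word m)) x \<noteq> 0" by auto
  then show "sum_list (map \<omega> m) + p = \<omega> x + q"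
    using assms *(1) unfolding homogeneous_def by blast
qed

lemma homogeneous_cce_component: "homogeneous L (\<lambda>b. deg L b + 1) 0 1 cce_component"
  unfolding cce_component_def
  by (intro homogeneous_sum homogeneous_dif_component homogeneous_partial_component)

lemma cce_component_word:
  "cce_component (word []) = 0" "cce_component (word [b]) = - dif L b"
  "cce_component (word [b, c]) = scl L ((-1) ^ (deg L b + 1) / 2) (brk L b c)"
  "cce_component (word (b # c # e # m)) = 0"
  by (simp_all add: cce_component_def cup_word_simps)

lemma cce_component_word_long: "length m > 2 \<Longrightarrow> cce_component (word m) = 0"
  by (cases m rule: word_length_cases) (simp_all add: cce_component_word)

lemma cce_component_coder:
  assumes \<beta>: "coalg_linear L (scl L) \<beta>"
  shows "cce_component (coder L k \<beta> f) = - dif L (\<beta> f) + scl L (1/2) (cup (coder L k \<beta> f))"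
  by (simp add: cce_component_def tau_coder)

lemma coder_word_Nil:
  assumes "coalg_linear L (scl L) \<beta>" "\<beta> (word []) = 0"
  shows "coder L k \<beta> (word []) = (\<lambda>w. 0)"
proof
  fix w
  have "\<beta> (\<lambda>m. word [] (u @ m @ v)) = 0" for u v
  proof (cases "u @ v")
    case Nil
    then show ?thesis using assms(2) by simp
  next
    case (Cons a x)
    then have "(\<lambda>m. word [] (u @ m @ v) :: 'k) = (\<lambda>m. 0)"
      by (auto simp: word_def fun_eq_iff)
    then show ?thesis using coalg_linear_zero[OF assms(1) module_scl] by simp
  qed
  then show "coder L k \<beta> (word []) w = 0"
    by (simp add: coder_def)
qed

lemma cce_component_zero: "cce_component (\<lambda>w. 0) = 0"
  by (rule coalg_linear_zero[OF coalg_linear_cce_component module_scl])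

lemma brk_grade_basis: "b \<in> basis L \<Longrightarrow> c \<in> basis L \<Longrightarrow> brk L b c \<in> grade L (deg L b + deg L c)"
  by (intro brk_grade basis_grade)

text \<open>
  So the square of the differential does not vanish on the whole tensor coalgebra; the cubic
  remainder is killed by symmetry.
\<close>

lemma cce_component_cce_diff_word:
  assumes m: "set m \<subseteq> basis L"
  shows "cce_component (cce_diff L (word m)) = (case m of
      [b, c, e] \<Rightarrow> scl L ((-1) ^ deg L c / 4) (brk L (brk L b c) e - brk L b (brk L c e))
    | _ \<Rightarrow> 0)"
proof -
  note lin = coalg_linear_cce_component
  note C = cce_component_coder[OF lin]
  note K = cup_coder_word[OF lin, where k = 1]
  show ?thesis
  proof (cases m rule: word_length_cases)
    case 1
    then show ?thesis
      by (simp add: cce_diff_eq coder_word_Nil[OF lin] cce_component_word cce_component_zero)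
  next
    case (2 b)
    then show ?thesis
      using K[of b "[]" "[]" b 0] m
      by (simp add: cce_diff_eq C cce_component_word dif_dif grade_simps)
  next
    case (3 b c)
    have bc: "b \<in> basis L" "c \<in> basis L" using m 3 by auto
    have "cup (coder L 1 cce_component (word [b, c]))
        = scl L ((-1) ^ (deg L b - 1 + 1)) (brk L (cce_component (word [b])) c)
          + scl L ((-1) ^ ((1 + 1) * (deg L b + 1))) (brk L b (cce_component (word [c])))"
      by (rule K) (use bc dif_basis_grade[OF bc(1)] in \<open>simp_all add: cce_component_word grade_simps\<close>)
    also have "\<dots> = - scl L ((-1) ^ (deg L b - 1 + 1)) (brk L (dif L b) c) - brk L b (dif L c)"
      by (simp add: cce_component_word)
    \<comment> \<open>For \<open>deg L b = 0\<close> the truncated exponent has the wrong parity,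
      but then \<open>dif L b = 0\<close>.\<close>
    also have "scl L ((-1) ^ (deg L b - 1 + 1)) (brk L (dif L b) c)
        = scl L ((-1) ^ deg L b) (brk L (dif L b) c)"
      using dif_deg_0[OF bc(1)] by (cases "deg L b") auto
    finally show ?thesis
      using 3 dif_brk[OF basis_grade[OF bc(1)], of c]
      by (simp add: cce_diff_eq C cce_component_word V.scale_right_distrib V.scale_right_diff_distrib)
  next
    case (4 b c e)
    have bce: "b \<in> basis L" "c \<in> basis L" "e \<in> basis L" using m 4 by auto
    \<comment> \<open>On three letters only a bracket followed by a bracket survives; the two
      factors 1/2 give the 1/4.\<close>
    have "cup (coder L 1 cce_component (word [b, c, e]))
        = scl L ((-1) ^ (deg L b + deg L c + 1)) (brk L (cce_component (word [b, c])) e)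
          + scl L ((-1) ^ ((1 + 1) * (deg L b + 1))) (brk L b (cce_component (word [c, e])))"
      by (rule K) (use bce in \<open>simp_all add: cce_component_word grade_simps brk_grade_basis\<close>)
    then show ?thesis
      using 4
      by (simp add: cce_diff_eq C cce_component_word V.scale_right_distrib
          V.scale_right_diff_distrib power_add)
  next
    case (5 b c e g n)
    \<comment> \<open>Dropping the first or the last letter leaves at least three letters, on which
      the component vanishes.\<close>
    obtain m' h where m': "c # e # g # n = m' @ [h]" "length m' \<ge> 2"
      by (rule that[of "butlast (c # e # g # n)" "last (c # e # g # n)"]) simp_all
    then obtain c' e' n' where "m' = c' # e' # n'"
      by (metis One_nat_def Suc_1 Suc_le_length_iff)
    with m' have "cup (coder L 1 cce_component (word m)) = 0"
      using K[of b "c # e # g # n" "b # m'" h 0] m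
      by (simp add: 5 cce_component_word_long grade_simps)
    then show ?thesis
      by (simp add: 5 cce_diff_eq C cce_component_word)
  qed
qed

lemma triple_sum_rename:
  "(\<Sum>b\<in>A. \<Sum>c\<in>A. \<Sum>e\<in>A. F b c e) = (\<Sum>b\<in>A. \<Sum>c\<in>A. \<Sum>e\<in>A. F c b (e :: 'b) :: 'c::comm_monoid_add)"
  "(\<Sum>b\<in>A. \<Sum>c\<in>A. \<Sum>e\<in>A. F b c e) = (\<Sum>b\<in>A. \<Sum>c\<in>A. \<Sum>e\<in>A. F c e b)"
proof -
  show 1: "(\<Sum>b\<in>A. \<Sum>c\<in>A. \<Sum>e\<in>A. F b c e) = (\<Sum>b\<in>A. \<Sum>c\<in>A. \<Sum>e\<in>A. F c b e)" for F :: "'b \<Rightarrow> 'b \<Rightarrow> 'b \<Rightarrow> 'c"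
    by (rule sum.swap)
  have "(\<Sum>b\<in>A. \<Sum>c\<in>A. \<Sum>e\<in>A. F b c e) = (\<Sum>b\<in>A. \<Sum>c\<in>A. \<Sum>e\<in>A. F b e c)"
    by (intro sum.cong refl sum.swap)
  also have "\<dots> = (\<Sum>b\<in>A. \<Sum>c\<in>A. \<Sum>e\<in>A. F c e b)" by (rule sum.swap)
  finally show "(\<Sum>b\<in>A. \<Sum>c\<in>A. \<Sum>e\<in>A. F b c e) = (\<Sum>b\<in>A. \<Sum>c\<in>A. \<Sum>e\<in>A. F c e b)" .
qed

text \<open>
  Graded symmetry identifies the three cyclic terms of the Jacobi identity up to sign, so that
  it reads \<open>3X = 0\<close>.
\<close>

lemma symmetrized_jacobi:
  assumes f: "f \<in> sym_coalg L" and A: "A \<subseteq> basis L"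
  shows "(\<Sum>b\<in>A. \<Sum>c\<in>A. \<Sum>e\<in>A. scl L (f [b, c, e] * (-1) ^ deg L c) (brk L b (brk L c e))) = 0"
    (is "?X = 0")
    and "(\<Sum>b\<in>A. \<Sum>c\<in>A. \<Sum>e\<in>A. scl L (f [b, c, e] * (-1) ^ deg L c) (brk L (brk L b c) e)) = 0"
    (is "?Y = 0")
proof -
  let ?J = "\<Sum>b\<in>A. \<Sum>c\<in>A. \<Sum>e\<in>A.
    scl L (f [b, c, e] * (-1) ^ (deg L c + deg L b * deg L c)) (brk L c (brk L b e))"
  have g: "b \<in> grade L (deg L b)" if "b \<in> A" for b
    using that A basis_grade by blast
  have jac: "?X = ?Y + ?J"
    unfolding sum.distrib[symmetric]
  proof (intro sum.cong refl)
    fix b c e assume "b \<in> A" "c \<in> A" "e \<in> A"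
    then show "scl L (f [b, c, e] * (-1) ^ deg L c) (brk L b (brk L c e))
      = scl L (f [b, c, e] * (-1) ^ deg L c) (brk L (brk L b c) e)
      + scl L (f [b, c, e] * (-1) ^ (deg L c + deg L b * deg L c)) (brk L c (brk L b e))"
      using brk_jacobi[OF g g, of b c e] by (simp add: V.scale_right_distrib power_add mult_ac)
  qed
  \<comment> \<open>Rename \<open>b\<close> and \<open>c\<close>, then transpose the first two
    letters of \<open>f\<close>.\<close>
  have J: "?J = - ?X"
    unfolding triple_sum_rename(1)[where F = "\<lambda>b c e.
      scl L (f [b, c, e] * (-1) ^ (deg L c + deg L b * deg L c)) (brk L c (brk L b e))"]
      sum_negf[symmetric]
  proof (intro sum.cong refl)
    fix b c e
    have s: "f [c, b, e] = (-1) ^ ((deg L c + 1) * (deg L b + 1)) * f [b, c, e]"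
      using sym_coalg_swap[OF f, of "[]" c b "[e]"] by simp
    have "(-1 :: 'k) ^ (((deg L c + 1) * (deg L b + 1)) + (deg L b + deg L c * deg L b)) = (-1) ^ (deg L c + 1)"
      by (rule minus_one_power_parity) (auto simp: algebra_simps)
    then have "f [c, b, e] * (-1) ^ (deg L b + deg L c * deg L b) = - (f [b, c, e] * (-1) ^ deg L c)"
      unfolding s power_add by (simp add: mult_ac)
    then show "scl L (f [c, b, e] * (-1) ^ (deg L b + deg L c * deg L b)) (brk L b (brk L c e))
      = - scl L (f [b, c, e] * (-1) ^ deg L c) (brk L b (brk L c e))"
      by simp
  qed
  \<comment> \<open>Rotate the three letters cyclically, then apply graded antisymmetry to the outer
    bracket.\<close>
  have Y: "?Y = - ?X"
    unfolding triple_sum_rename(2)[where F = "\<lambda>b c e.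
      scl L (f [b, c, e] * (-1) ^ deg L c) (brk L (brk L b c) e)"]
      sum_negf[symmetric]
  proof (intro sum.cong refl)
    fix b c e assume A: "b \<in> A" "c \<in> A" "e \<in> A"
    have s: "f [c, e, b] = (-1) ^ ((deg L b + 1) * (deg L c + deg L e + 2)) * f [b, c, e]"
      using sym_coalg_move[OF f, of "[]" "[c, e]" b] by (simp add: add_ac)
    have "(-1 :: 'k) ^ (((deg L b + 1) * (deg L c + deg L e + 2)) + deg L e + (deg L c + deg L e) * deg L b)
        = (-1) ^ deg L c"
      by (rule minus_one_power_parity) (auto simp: algebra_simps)
    then have *: "f [c, e, b] * (-1) ^ deg L e * (-1) ^ ((deg L c + deg L e) * deg L b) = f [b, c, e] * (-1) ^ deg L c"
      unfolding s power_add by (simp add: mult_ac)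
    show "scl L (f [c, e, b] * (-1) ^ deg L e) (brk L (brk L c e) b)
      = - scl L (f [b, c, e] * (-1) ^ deg L c) (brk L b (brk L c e))"
      unfolding brk_antisym[OF brk_grade[OF g[OF A(2)] g[OF A(3)]] g[OF A(1)]]
      using * by simp
  qed
  have "?X = - ?X - ?X" using jac unfolding J Y by simp
  then have "scl L 3 ?X = 0"
    by (simp only: V.scale_left_distrib[of 1 2 ?X, simplified] V.scale_left_distrib[of 1 1 ?X, simplified])
      (simp add: algebra_simps)
  then show "?X = 0" by simp
  with Y show "?Y = 0" by simp
qed

lemma cce_component_cce_diff:
  assumes f: "f \<in> sym_coalg L"
  shows "cce_component (cce_diff L f) = 0"
proof -
  note lin = coalg_linear_cce_component
  have ft: "f \<in> tensor_coalg L" using f sym_coalg_subset by blast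
  define S where "S = {m. f m \<noteq> 0}"
  define A where "A = (\<Union>m\<in>S. set m)"
  \<comment> \<open>All triples over the letters of \<open>f\<close> are included, also those with
    coefficient zero: the symmetrization needs an index set closed under permutation.\<close>
  let ?T = "(\<lambda>(b, c, e). [b, c, e]) ` (A \<times> A \<times> A)"
  have S: "finite S" using ft by (simp add: S_def tensor_coalg_def)
  then have A: "finite A" by (auto simp: A_def)
  have AB: "A \<subseteq> basis L" using ft by (auto simp: A_def S_def tensor_coalg_def)
  have TB: "set m \<subseteq> basis L" if "m \<in> S \<union> ?T" for m
  proof -
    have "set m \<subseteq> A" using that by (force simp: A_def)
    then show ?thesis using AB by blast
  qed
  have "cce_component (cce_diff L f)
      = (\<Sum>m\<in>S \<union> ?T. scl L (f m) (cce_component (cce_diff L (word m))))"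
    unfolding cce_diff_eq
    by (rule coalg_linear_eq_sum[OF coalg_linear_coder_comp[OF lin lin] module_scl ft])
      (use S A in \<open>auto simp: S_def\<close>)
  also have "\<dots> = (\<Sum>m\<in>?T. scl L (f m) (cce_component (cce_diff L (word m))))"
  proof (rule sum.mono_neutral_right)
    show "finite (S \<union> ?T)" using S A by simp
    show "\<forall>m\<in>S \<union> ?T - ?T. scl L (f m) (cce_component (cce_diff L (word m))) = 0"
    proof
      fix m assume m: "m \<in> S \<union> ?T - ?T"
      have neq: "m \<noteq> [b, c, e]" for b c e
      proof
        assume "m = [b, c, e]"
        moreover from this have "b \<in> A" "c \<in> A" "e \<in> A" using m by (force simp: A_def)+
        ultimately have "m \<in> ?T" by (auto intro: image_eqI[of _ _ "(b, c, e)"])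
        then show False using m by blast
      qed
      have "set m \<subseteq> basis L" using m TB by blast
      then have "cce_component (cce_diff L (word m)) = 0"
        using neq by (auto simp: cce_component_cce_diff_word split: list.split)
      then show "scl L (f m) (cce_component (cce_diff L (word m))) = 0" by simp
    qed
  qed simp
  also have "\<dots> = (\<Sum>(b, c, e)\<in>A \<times> A \<times> A. scl L (f [b, c, e]) (cce_component (cce_diff L (word [b, c, e]))))"
    by (subst sum.reindex) (auto simp: inj_on_def case_prod_unfold)
  also have "\<dots> = (\<Sum>b\<in>A. \<Sum>c\<in>A. \<Sum>e\<in>A. scl L (f [b, c, e]) (cce_component (cce_diff L (word [b, c, e]))))"
    by (simp add: sum.cartesian_product)
  also have "\<dots> = (\<Sum>b\<in>A. \<Sum>c\<in>A. \<Sum>e\<in>A. scl L (1/4)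
      (scl L (f [b, c, e] * (-1) ^ deg L c) (brk L (brk L b c) e)
        - scl L (f [b, c, e] * (-1) ^ deg L c) (brk L b (brk L c e))))"
  proof (intro sum.cong refl)
    fix b c e assume "b \<in> A" "c \<in> A" "e \<in> A"
    then have "set [b, c, e] \<subseteq> basis L" using AB by auto
    from cce_component_cce_diff_word[OF this]
    show "scl L (f [b, c, e]) (cce_component (cce_diff L (word [b, c, e]))) = scl L (1/4)
      (scl L (f [b, c, e] * (-1) ^ deg L c) (brk L (brk L b c) e)
        - scl L (f [b, c, e] * (-1) ^ deg L c) (brk L b (brk L c e)))"
      by (simp add: V.scale_right_diff_distrib)
  qed
  also have "\<dots> = 0"
    unfolding V.scale_sum_right[symmetric] sum_subtractf symmetrized_jacobi[OF f AB] by simp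
  finally show ?thesis .
qed

lemma cce_diff_sym_coalg: "f \<in> sym_coalg L \<Longrightarrow> cce_diff L f \<in> sym_coalg L"
  unfolding cce_diff_eq
  using coder_sym_coalg[OF coalg_linear_cce_component homogeneous_cce_component] by simp

text \<open>The differential is odd, so its graded commutator with itself is twice its square; on
  symmetric elements this is the coderivation with component 0.\<close>

lemma cce_diff_cce_diff:
  assumes "f \<in> sym_coalg L" shows "cce_diff L (cce_diff L f) = (\<lambda>w. 0)"
proof
  fix w
  have "cce_diff L (cce_diff L f) w = (-1) ^ (1 * 1) * cce_diff L (cce_diff L f) w
      + coder L (1 + 1) (\<lambda>_. 0) f w"
    unfolding cce_diff_eq
    by (rule coder_commutatorI[OF coalg_linear_cce_component homogeneous_cce_component
          coalg_linear_cce_component homogeneous_cce_component _ _ sym_coalg_subset slice_sym_coalg _ assms])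
      (simp_all add: cce_component_cce_diff[unfolded cce_diff_eq, simplified])
  then show "cce_diff L (cce_diff L f) w = 0"
    by (simp add: coder_def eq_neg_iff_add_eq_0)
qed

section \<open>The action on the CCE coalgebra\<close>

lemma coalg_linear_act_component: "coalg_linear L (scl L) (\<lambda>f. brk L x (tau L f))"
  by (rule coalg_linear_compose[OF coalg_linear_tau]) simp_all

lemma homogeneous_act_component:
  assumes "x \<in> grade L 0"
  shows "homogeneous L (\<lambda>b. deg L b + 1) 0 0 (\<lambda>f. brk L x (tau L f))"
  unfolding homogeneous_def
proof (intro allI impI)
  fix m y assume "set m \<subseteq> basis L" "rep (brk L x (tau L (word m))) y \<noteq> 0"
  then show "(\<Sum>b\<leftarrow>m. deg L b + 1) + 0 = deg L y + 1 + 0"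
    using grade_rep_nonzero[OF brk_grade[OF assms basis_grade], of "hd m" y]
    by (cases m rule: word_length_cases) auto
qed

text \<open>On one letter this is \<open>d[x, y] = [x, dy]\<close>, as \<open>dx = 0\<close>; on two
  letters it is the Jacobi identity; otherwise both sides vanish. No symmetry is involved, so words
  decide.\<close>

lemma cce_component_act:
  assumes x: "x \<in> grade L 0" and f: "f \<in> tensor_coalg L"
  shows "cce_component (cce_act L x f) = brk L x (cce_component f)"
  unfolding cce_act_def
proof (rule coalg_linear_eqI[OF _ _ module_scl f])
  note lin = coalg_linear_act_component[of x]
  show "coalg_linear L (scl L) (\<lambda>f. cce_component (coder L 0 (\<lambda>f. brk L x (tau L f)) f))"
    by (rule coalg_linear_coder_comp[OF coalg_linear_cce_component lin])
  show "coalg_linear L (scl L) (\<lambda>f. brk L x (cce_component f))"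
    by (rule coalg_linear_compose[OF coalg_linear_cce_component]) simp_all
  fix m assume m: "set m \<subseteq> basis L"
  note K = cup_coder_word[OF lin, where k = 0]
  note C = cce_component_coder[OF lin]
  have g: "brk L x b \<in> grade L (deg L b)" if "b \<in> basis L" for b
    using brk_grade[OF x basis_grade[OF that]] by simp
  have dx: "dif L (brk L x y) = brk L x (dif L y)" for y
    using dif_brk[OF x, of y] dif_grade_0[OF x] by simp
  show "cce_component (coder L 0 (\<lambda>f. brk L x (tau L f)) (word m)) = brk L x (cce_component (word m))"
  proof (cases m rule: word_length_cases)
    case 1
    then show ?thesis
      by (simp add: coder_word_Nil[OF lin] cce_component_word cce_component_zero)
  next
    case (2 b)
    then show ?thesis
      using K[of b "[]" "[]" b 0] m by (simp add: C cce_component_word dx grade_simps)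
  next
    case (3 b c)
    then have b: "b \<in> basis L" "c \<in> basis L" using m by auto
    have "brk L x (brk L b c) = brk L (brk L x b) c + brk L b (brk L x c)"
      using brk_jacobi[OF x basis_grade[OF b(1)], of c] by simp
    moreover have "cup (coder L 0 (\<lambda>f. brk L x (tau L f)) (word [b, c]))
        = scl L ((-1) ^ (deg L b + 1)) (brk L (brk L x (tau L (word [b]))) c)
          + scl L ((-1) ^ ((0 + 1) * (deg L b + 1))) (brk L b (brk L x (tau L (word [c]))))"
      by (rule K) (use b g in simp_all)
    ultimately show ?thesis
      using 3 by (simp add: C cce_component_word V.scale_right_distrib V.scale_right_diff_distrib)
  next
    case (4 b c e)
    have "cup (coder L 0 (\<lambda>f. brk L x (tau L f)) (word [b, c, e]))
        = scl L ((-1) ^ (0 + 1)) (brk L (brk L x (tau L (word [b, c]))) e)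
          + scl L ((-1) ^ ((0 + 1) * (deg L b + 1))) (brk L b (brk L x (tau L (word [c, e]))))"
      by (rule K) (use m 4 in \<open>simp_all add: grade_simps\<close>)
    then show ?thesis
      using 4 by (simp add: C cce_component_word)
  next
    case (5 b c e g n)
    obtain m' h where m': "c # e # g # n = m' @ [h]" "length m' \<ge> 2"
      by (rule that[of "butlast (c # e # g # n)" "last (c # e # g # n)"]) simp_all
    then obtain c' e' n' where "m' = c' # e' # n'"
      by (metis One_nat_def Suc_1 Suc_le_length_iff)
    with m' have "cup (coder L 0 (\<lambda>f. brk L x (tau L f)) (word m)) = 0"
      using K[of b "c # e # g # n" "b # m'" h 0] m
      by (simp add: 5 grade_simps)
    then show ?thesis
      by (simp add: 5 C cce_component_word)
  qed
qed

lemma cce_act_cce_diff: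
  assumes x: "x \<in> grade L 0" and f: "f \<in> tensor_coalg L"
  shows "cce_act L x (cce_diff L f) = cce_diff L (cce_act L x f)"
proof
  fix w
  have "cce_act L x (cce_diff L f) w = (-1) ^ (0 * 1) * cce_diff L (cce_act L x f) w
      + coder L (0 + 1) (\<lambda>_. 0) f w"
    unfolding cce_diff_eq cce_act_def
    by (rule coder_commutatorI[OF coalg_linear_act_component homogeneous_act_component[OF x]
          coalg_linear_cce_component homogeneous_cce_component _ _ order_refl slice_tensor_coalg _ f])
      (simp_all add: tau_coder[unfolded One_nat_def] cce_component_act[OF x, unfolded cce_act_def])
  then show "cce_act L x (cce_diff L f) w = cce_diff L (cce_act L x f) w"
    by (simp add: coder_def)
qed

lemma cce_act_sym_coalg:
  "x \<in> grade L 0 \<Longrightarrow> f \<in> sym_coalg L \<Longrightarrow> cce_act L x f \<in> sym_coalg L"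
  unfolding cce_act_def
  using coder_sym_coalg[OF coalg_linear_act_component homogeneous_act_component] by simp

end

section \<open>Homological perturbation\<close>

text \<open>Nilpotency is local: the exponent may depend on \<open>f\<close>, since word lengths are
  unbounded on the whole coalgebra. Additivity suffices, with scalars to be treated as additive maps
  commuting with \<open>T\<close> and \<open>h\<close>.\<close>

locale perturbation =
  fixes W :: "'v::ab_group_add set" and T h :: "'v \<Rightarrow> 'v"
  assumes zero: "0 \<in> W" and diff: "f \<in> W \<Longrightarrow> g \<in> W \<Longrightarrow> f - g \<in> W"
    and T: "f \<in> W \<Longrightarrow> T f \<in> W" "f \<in> W \<Longrightarrow> g \<in> W \<Longrightarrow> T (f + g) = T f + T g"
    and h: "f \<in> W \<Longrightarrow> h f \<in> W" "f \<in> W \<Longrightarrow> g \<in> W \<Longrightarrow> h (f + g) = h f + h g"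
    and nilpotent: "f \<in> W \<Longrightarrow> \<exists>n. (T ^^ n) f = 0"
begin

lemma add: "f \<in> W \<Longrightarrow> g \<in> W \<Longrightarrow> f + g \<in> W"
  using diff[of f "0 - g"] diff[OF zero, of g] by simp

lemma sum_in: "(\<And>i. i \<in> I \<Longrightarrow> F i \<in> W) \<Longrightarrow> sum F I \<in> W"
  by (induction I rule: infinite_finite_induct) (auto intro: zero add)

lemma additive_zero:
  assumes "\<And>f g. f \<in> W \<Longrightarrow> g \<in> W \<Longrightarrow> A (f + g) = A f + A g" shows "A 0 = (0 :: 'v)"
  using assms[OF zero zero] by simp

lemma additive_diff:
  assumes "\<And>f g. f \<in> W \<Longrightarrow> g \<in> W \<Longrightarrow> A (f + g) = A f + (A g :: 'v)" "f \<in> W" "g \<in> W"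
  shows "A (f - g) = A f - A g"
  using assms(1)[OF diff[OF assms(2,3)] assms(3)] by (simp add: algebra_simps)

lemma additive_sum:
  assumes A: "\<And>f g. f \<in> W \<Longrightarrow> g \<in> W \<Longrightarrow> A (f + g) = A f + (A g :: 'v)"
    and F: "\<And>i. i \<in> I \<Longrightarrow> F i \<in> W"
  shows "A (sum F I) = (\<Sum>i\<in>I. A (F i))"
  using F
  by (induction I rule: infinite_finite_induct) (simp_all add: additive_zero[OF A] A sum_in)

lemma T_zero: "T 0 = 0" and h_zero: "h 0 = 0"
  using additive_zero[OF T(2)] additive_zero[OF h(2)] by blast+

lemma funpow_T:
  "f \<in> W \<Longrightarrow> (T ^^ n) f \<in> W"
  "f \<in> W \<Longrightarrow> g \<in> W \<Longrightarrow> (T ^^ n) (f + g) = (T ^^ n) f + (T ^^ n) g"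
proof -
  show 1: "(T ^^ n) f \<in> W" if "f \<in> W" for f
    using that by (induction n) (auto intro: T)
  show "(T ^^ n) (f + g) = (T ^^ n) f + (T ^^ n) g" if "f \<in> W" "g \<in> W"
  proof (induction n)
    case (Suc n)
    have "(T ^^ m) f \<in> W" "(T ^^ m) g \<in> W" for m
      using that by (induction m) (auto intro: T)
    then show ?case using Suc by (simp add: T(2))
  qed simp
qed

lemma funpow_T_zero:
  assumes "(T ^^ n) f = 0" "n \<le> m" shows "(T ^^ m) f = 0"
proof -
  have "(T ^^ k) 0 = 0" for k by (induction k) (simp_all add: T_zero)
  then show ?thesis
    using assms funpow_add[of "m - n" n T] by simp
qed

text \<open>The series stops at the first power of \<open>T\<close> that kills \<open>f\<close>. By
  \<open>H_eq\<close> any later bound gives the same value, so two elements can share one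
  bound.\<close>

definition H :: "'v \<Rightarrow> 'v"
  where "H f = (\<Sum>i<(LEAST n. (T ^^ n) f = 0). h ((T ^^ i) f))"

lemma H_eq:
  assumes "(T ^^ n) f = 0" shows "H f = (\<Sum>i<n. h ((T ^^ i) f))"
proof -
  let ?m = "LEAST n. (T ^^ n) f = 0"
  have m: "(T ^^ ?m) f = 0" "?m \<le> n" using assms by (rule LeastI, intro Least_le)
  have "(\<Sum>i<n. h ((T ^^ i) f)) = (\<Sum>i<?m. h ((T ^^ i) f))"
    by (rule sum.mono_neutral_right) (use m(2) funpow_T_zero[OF m(1)] in \<open>auto simp: h_zero\<close>)
  then show ?thesis by (simp add: H_def)
qed

lemma H_in: "f \<in> W \<Longrightarrow> H f \<in> W"
  unfolding H_def by (intro sum_in h(1) funpow_T)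

lemma H_add:
  assumes "f \<in> W" "g \<in> W" shows "H (f + g) = H f + H g"
proof -
  obtain n m where "(T ^^ n) f = 0" "(T ^^ m) g = 0" using nilpotent assms by blast
  then have *: "(T ^^ (n + m)) f = 0" "(T ^^ (n + m)) g = 0"
    by (auto intro: funpow_T_zero)
  then have "(T ^^ (n + m)) (f + g) = 0" using assms by (simp add: funpow_T)
  then show ?thesis
    unfolding H_eq[OF *(1)] H_eq[OF *(2)]
    using assms by (simp add: H_eq funpow_T h(2) sum.distrib)
qed

text \<open>Serves twice: with \<open>A\<close> a scalar multiplication it gives homogeneity, with
  \<open>A\<close> the action of a Lie algebra element it gives equivariance.\<close>

lemma H_commute:
  assumes A: "\<And>f. f \<in> W \<Longrightarrow> A f \<in> W" "\<And>f g. f \<in> W \<Longrightarrow> g \<in> W \<Longrightarrow> A (f + g) = A f + (A g :: 'v)"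
    and AT: "\<And>f. f \<in> W \<Longrightarrow> A (T f) = T (A f)" and Ah: "\<And>f. f \<in> W \<Longrightarrow> A (h f) = h (A f)"
    and f: "f \<in> W"
  shows "H (A f) = A (H f)"
proof -
  have p: "(T ^^ i) (A f) = A ((T ^^ i) f)" for i
    by (induction i) (simp_all add: AT funpow_T f)
  obtain n where n: "(T ^^ n) f = 0" using nilpotent f by blast
  then have "(T ^^ n) (A f) = 0" using p[of n] additive_zero[of A] A(2) by simp
  then have "H (A f) = (\<Sum>i<n. A (h ((T ^^ i) f)))" by (simp add: H_eq p Ah funpow_T f)
  also have "\<dots> = A (\<Sum>i<n. h ((T ^^ i) f))"
    by (rule additive_sum[symmetric]) (auto intro: A h(1) funpow_T f)
  finally show ?thesis by (simp add: H_eq[OF n])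
qed

lemma H_graded:
  assumes "\<And>f. f \<in> V \<Longrightarrow> T f \<in> V" "\<And>f. f \<in> V \<Longrightarrow> h f \<in> V'"
    and "0 \<in> V'" "\<And>f g. f \<in> V' \<Longrightarrow> g \<in> V' \<Longrightarrow> f + g \<in> V'" and "f \<in> V"
  shows "H f \<in> V'"
proof -
  have "(T ^^ i) f \<in> V" for i by (induction i) (simp_all add: assms)
  then have "(\<Sum>i<n. h ((T ^^ i) f)) \<in> V'" for n
    by (induction n) (simp_all add: assms)
  then show ?thesis unfolding H_def .
qed

text \<open>
  \<open>Id - p - T = Dh + hD\<close> and \<open>T\<close> commutes with \<open>D\<close>, so composing \<open>h\<close> with the geometric
  series \<open>\<Sum>T\<^sup>i = (Id - T)\<^sup>-\<^sup>1\<close> removes \<open>T\<close>.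
\<close>

lemma H_homotopy:
  assumes D: "\<And>f. f \<in> W \<Longrightarrow> D f \<in> W" "\<And>f g. f \<in> W \<Longrightarrow> g \<in> W \<Longrightarrow> D (f + g) = D f + (D g :: 'v)"
    and DD: "\<And>f. f \<in> W \<Longrightarrow> D (D f) = 0"
    and p: "\<And>f. f \<in> W \<Longrightarrow> p f \<in> W" "\<And>f. f \<in> W \<Longrightarrow> D (p f) = 0" "\<And>f. f \<in> W \<Longrightarrow> p (D f) = 0"
      "\<And>f. f \<in> W \<Longrightarrow> p (T f) = 0"
    and T_def: "\<And>f. f \<in> W \<Longrightarrow> T f = f - p f - D (h f) - h (D f)"
    and f: "f \<in> W"
  shows "D (H f) + H (D f) = f - p f"
proof -
  note Dd = additive_diff[OF D(2)]
  \<comment> \<open>Both sides expand to \<open>D f - D (h (D f))\<close>.\<close>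
  have DT: "D (T f) = T (D f)" if f: "f \<in> W" for f
    using f by (simp add: T_def Dd diff D(1) h(1) p DD h_zero)
  have DTn: "(T ^^ i) (D f) = D ((T ^^ i) f)" for i
    by (induction i) (simp_all add: DT funpow_T f)
  have D0: "D 0 = 0" by (rule additive_zero[OF D(2)])
  obtain m where m: "(T ^^ m) f = 0" using nilpotent f by blast
  \<comment> \<open>A bound of at least 1, so that the sum over \<open>p\<close> below contains the
    term \<open>i = 0\<close>, the only one left by \<open>p (T f) = 0\<close>.\<close>
  define n where "n = Suc m"
  have n: "(T ^^ n) f = 0" unfolding n_def by (rule funpow_T_zero[OF m]) simp
  then have n': "(T ^^ n) (D f) = 0" by (simp add: DTn D0)
  have "D (H f) + H (D f) = (\<Sum>i<n. D (h ((T ^^ i) f)) + h (D ((T ^^ i) f)))"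
    unfolding H_eq[OF n] H_eq[OF n'] DTn sum.distrib
    by (subst additive_sum[OF D(2)]) (auto intro: h(1) funpow_T f)
  \<comment> \<open>\<open>D h + h D = Id - p - T\<close> at each power of \<open>T\<close>; the
    differences then telescope.\<close>
  also have "\<dots> = (\<Sum>i<n. ((T ^^ i) f - (T ^^ Suc i) f) - p ((T ^^ i) f))"
    by (rule sum.cong) (simp_all add: T_def[OF funpow_T(1)[OF f]])
  also have "\<dots> = (f - (T ^^ n) f) - (\<Sum>i<n. p ((T ^^ i) f))"
    using sum_lessThan_telescope'[of "\<lambda>i. (T ^^ i) f" n] by (simp add: sum_subtractf)
  also have "(\<Sum>i<n. p ((T ^^ i) f)) = p f"
    unfolding n_def sum.lessThan_Suc_shift by (simp add: p(4) funpow_T f)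
  finally show ?thesis by (simp add: n)
qed

end

section \<open>Contractible differential graded Lie algebras\<close>

text \<open>\<open>s\<close> contracts the underlying complex only; its failure to respect the
  bracket is what the perturbation argument corrects.\<close>

locale contractible_dg_lie_algebra = dg_lie_algebra L
  for L :: "('k::field_char_0, 'a::ab_group_add) dgl" +
  fixes s :: "'a \<Rightarrow> 'a"
  assumes s_add: "s (x + y) = s x + s y" and s_scale: "s (scl L r x) = scl L r (s x)"
    and s_grade: "x \<in> grade L n \<Longrightarrow> s x \<in> grade L (n + 1)"
    and s_homotopy: "dif L (s x) + s (dif L x) = x"
begin

abbreviation W :: "('a list \<Rightarrow> 'k) set" where "W \<equiv> sym_coalg L"
abbreviation D :: "('a list \<Rightarrow> 'k) \<Rightarrow> 'a list \<Rightarrow> 'k" where "D \<equiv> cce_diff L"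

lemma s_simps: "s 0 = 0" "s (- x) = - s x"
  using s_scale[of 0 0] s_scale[of "-1" x] by simp_all

text \<open>On the empty word this is 0, since \<open>inverse 0 = 0\<close>.\<close>

definition length_inverse :: "('a list \<Rightarrow> 'k) \<Rightarrow> 'a list \<Rightarrow> 'k"
  where "length_inverse f w = inverse (of_nat (length w)) * f w"

text \<open>The minus sign matches the one in \<open>cce_d\<close>; the two cancel in the
  commutator.\<close>

definition s_coder :: "('a list \<Rightarrow> 'k) \<Rightarrow> 'a list \<Rightarrow> 'k"
  where "s_coder = coder L 1 (\<lambda>f. - s (tau L f))"

definition homotopy :: "('a list \<Rightarrow> 'k) \<Rightarrow> 'a list \<Rightarrow> 'k"
  where "homotopy f = s_coder (length_inverse f)"

lemma coalg_linear_s_component: "coalg_linear L (scl L) (\<lambda>f. - s (tau L f))"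
  by (rule coalg_linear_compose[OF coalg_linear_tau]) (simp_all add: s_add s_scale)

lemma homogeneous_s_component: "homogeneous L (\<lambda>b. deg L b + 1) 1 0 (\<lambda>f. - s (tau L f))"
  unfolding homogeneous_def
proof (intro allI impI)
  fix m x assume "set m \<subseteq> basis L" "rep (- s (tau L (word m))) x \<noteq> 0"
  then show "(\<Sum>b\<leftarrow>m. deg L b + 1) + 1 = deg L x + 1 + 0"
    using grade_rep_nonzero[OF s_grade[OF basis_grade], of "hd m" x]
    by (cases m rule: word_length_cases) (auto simp: s_simps)
qed

lemma homogeneous_length_s_component: "homogeneous L (\<lambda>b. 1) 0 0 (\<lambda>f. - s (tau L f))"
  unfolding homogeneous_def
proof (intro allI impI)
  fix m x assume "rep (- s (tau L (word m))) x \<noteq> 0"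
  then show "(\<Sum>b\<leftarrow>m. 1) + 0 = 1 + (0::nat)"
    by (cases m rule: word_length_cases) (auto simp: s_simps)
qed

lemma rep_tau: "f \<in> tensor_coalg L \<Longrightarrow> rep (tau L f) x = f [x]"
proof (rule coalg_linear_eqI[where s = "(*)" and l = "\<lambda>f. rep (tau L f) x" and l' = "\<lambda>f. f [x]"])
  show "coalg_linear L (*) (\<lambda>f. rep (tau L f) x)"
    by (rule coalg_linear_rep[OF coalg_linear_tau])
  show "coalg_linear L (*) (\<lambda>f. f [x])" by (simp add: coalg_linear_def)
  show "rep (tau L (word m)) x = word m [x]" if "set m \<subseteq> basis L" for m
  proof -
    have "word m [x] = (if m = [x] then 1 else 0 :: 'k)" by (auto simp: word_def)
    then show ?thesis
      using that by (cases m rule: word_length_cases) (auto simp: rep_basis)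
  qed
qed (rule module_field)

text \<open>The Euler operator: every position of \<open>w\<close> contributes \<open>f w\<close>
  once. The parity argument 2 comes from composing two odd maps.\<close>

lemma coder_tau: "f \<in> tensor_coalg L \<Longrightarrow> coder L 2 (tau L) f w = of_nat (length w) * f w"
proof -
  assume f: "f \<in> tensor_coalg L"
  have "coder L 2 (tau L) f w = (\<Sum>i<length w. f w)"
    unfolding coder_def
  proof (intro sum.cong refl)
    fix i assume "i \<in> {..<length w}"
    then show "(-1) ^ (2 * wdeg L (take i w)) * rep (tau L (\<lambda>m. f (take i w @ m @ drop (Suc i) w))) (w ! i) = f w"
      using rep_tau[OF slice_tensor_coalg[OF f, of "take i w" "drop (Suc i) w"], of "w ! i"]
        id_take_nth_drop[of i w] by (simp add: power_mult)
  qed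
  then show ?thesis by simp
qed

text \<open>A component that factors through \<open>tau\<close> replaces one letter by one letter,
  so the coderivation preserves word length and commutes with division by it.\<close>

lemma length_inverse_coder:
  assumes f: "f \<in> tensor_coalg L"
    and l: "\<And>r x. l (scl L r x) = scl L r (l x)"
  shows "coder L k (\<lambda>f. l (tau L f)) (length_inverse f)
    = length_inverse (coder L k (\<lambda>f. l (tau L f)) f)"
proof
  fix w
  show "coder L k (\<lambda>f. l (tau L f)) (length_inverse f) w
    = length_inverse (coder L k (\<lambda>f. l (tau L f)) f) w"
    unfolding length_inverse_def[of "coder L k _ f"] coder_def sum_distrib_left
  proof (rule sum.cong[OF refl])
    fix i assume i: "i \<in> {..<length w}"
    let ?g = "\<lambda>m. f (take i w @ m @ drop (Suc i) w)"
    let ?r = "inverse (of_nat (length w)) :: 'k"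
    have "tau L (\<lambda>m. length_inverse f (take i w @ m @ drop (Suc i) w)) = tau L (\<lambda>m. ?r * ?g m)"
      by (rule tau_cong) (use i in \<open>simp add: length_inverse_def Suc_diff_le\<close>)
    also have "\<dots> = scl L ?r (tau L ?g)"
      by (rule coalg_linearD(2)[OF coalg_linear_tau slice_tensor_coalg[OF f]])
    finally show "(-1) ^ (k * wdeg L (take i w)) *
        rep (l (tau L (\<lambda>m. length_inverse f (take i w @ m @ drop (Suc i) w)))) (w ! i)
      = ?r * ((-1) ^ (k * wdeg L (take i w)) * rep (l (tau L ?g)) (w ! i))"
      by (simp add: l)
  qed
qed

lemma length_inverse_tensor_coalg: "f \<in> tensor_coalg L \<Longrightarrow> length_inverse f \<in> tensor_coalg L"
  unfolding length_inverse_def by (rule tensor_coalg_scale)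

lemma homotopy_eq: "f \<in> tensor_coalg L \<Longrightarrow> homotopy f = length_inverse (s_coder f)"
  unfolding homotopy_def s_coder_def
  by (rule length_inverse_coder[where l = "\<lambda>x. - s x"]) (simp_all add: s_scale)

lemma s_coder_tensor_coalg: "f \<in> tensor_coalg L \<Longrightarrow> s_coder f \<in> tensor_coalg L"
  unfolding s_coder_def by (rule coder_tensor_coalg[OF coalg_linear_s_component])

lemma homotopy_tensor_coalg: "f \<in> tensor_coalg L \<Longrightarrow> homotopy f \<in> tensor_coalg L"
  unfolding homotopy_def by (intro s_coder_tensor_coalg length_inverse_tensor_coalg)

lemma sym_tensor: "f \<in> W \<Longrightarrow> f \<in> tensor_coalg L"
  using sym_coalg_subset by blast

lemma homotopy_sym_coalg:
  assumes "f \<in> W" shows "homotopy f \<in> W"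
proof -
  have "length_inverse f \<in> W"
  proof (rule sym_coalgI)
    show "length_inverse f \<in> tensor_coalg L"
      by (rule length_inverse_tensor_coalg[OF sym_tensor[OF assms]])
    show "length_inverse f (u @ [x, y] @ v)
      = (-1) ^ ((deg L x + 1) * (deg L y + 1)) * length_inverse f (u @ [y, x] @ v)" for u x y v
      using sym_coalg_swap[OF assms, of u x y v] by (simp add: length_inverse_def)
  qed
  then show ?thesis
    unfolding homotopy_def s_coder_def
    using coder_sym_coalg[OF coalg_linear_s_component homogeneous_s_component] by simp
qed

lemma homotopy_add:
  assumes "f \<in> tensor_coalg L" "g \<in> tensor_coalg L"
  shows "homotopy (\<lambda>w. f w + g w) = (\<lambda>w. homotopy f w + homotopy g w)"
  unfolding homotopy_def s_coder_def
  using coder_linear(1)[OF coalg_linear_s_component length_inverse_tensor_coalg[OF assms(1)]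
      length_inverse_tensor_coalg[OF assms(2)]]
  by (simp add: length_inverse_def[abs_def] distrib_left)

lemma homotopy_scale:
  assumes "f \<in> tensor_coalg L"
  shows "homotopy (\<lambda>w. r * f w) = (\<lambda>w. r * homotopy f w)"
  unfolding homotopy_def s_coder_def
  using coder_linear(2)[OF coalg_linear_s_component length_inverse_tensor_coalg[OF assms(1)], of 1 r]
  by (simp add: length_inverse_def[abs_def] mult.left_commute)

section \<open>Contraction of the linear part and the perturbation term\<close>

lemma cce_d_tensor_coalg: "f \<in> tensor_coalg L \<Longrightarrow> cce_d L f \<in> tensor_coalg L"
  unfolding cce_d_def by (rule coder_tensor_coalg[OF coalg_linear_dif_component])

lemma cce_partial_tensor_coalg: "f \<in> tensor_coalg L \<Longrightarrow> cce_partial L f \<in> tensor_coalg L"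
  unfolding cce_partial_def using coder_tensor_coalg[OF coalg_linear_partial_component] by simp

text \<open>The component of the commutator is \<open>(ds + sd)\<close> applied after
  \<open>tau\<close>, which is \<open>tau\<close> itself, so the commutator is the Euler
  operator.\<close>

lemma cce_d_s_coder:
  assumes f: "f \<in> tensor_coalg L"
  shows "cce_d L (s_coder f) w + s_coder (cce_d L f) w = of_nat (length w) * f w"
proof -
  have h: "dif L (s x) = x - s (dif L x)" for x
    using s_homotopy[of x] by (simp add: algebra_simps)
  have "cce_d L (s_coder f) w = (-1) ^ (1 * 1) * s_coder (cce_d L f) w + coder L (1 + 1) (tau L) f w"
    unfolding cce_d_def s_coder_def
    by (rule coder_commutatorI[OF coalg_linear_dif_component homogeneous_dif_component
          coalg_linear_s_component homogeneous_s_component _ _ order_refl slice_tensor_coalg _ f])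
      (simp_all add: tau_coder[unfolded One_nat_def] s_simps h)
  then show ?thesis using coder_tau[OF f] by (simp add: numeral_2_eq_2)
qed

lemma cce_d_homotopy:
  assumes f: "f \<in> tensor_coalg L"
  shows "cce_d L (homotopy f) w + homotopy (cce_d L f) w = f w - coaug (counit f) w"
proof -
  have "cce_d L (homotopy f) = length_inverse (cce_d L (s_coder f))"
    unfolding homotopy_eq[OF f] cce_d_def
    by (rule length_inverse_coder[OF s_coder_tensor_coalg[OF f], where l = "\<lambda>x. - dif L x"]) simp
  then show ?thesis
    unfolding homotopy_eq[OF cce_d_tensor_coalg[OF f]]
    using cce_d_s_coder[OF f, of w]
    \<comment> \<open>On the empty word \<open>inverse 0 = 0\<close> makes the left side 0, and the
      right side is 0 because the counit reads off the coefficient there.\<close>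
    by (auto simp: length_inverse_def distrib_left[symmetric] coaug_def counit_def)
qed

lemma cce_diff_split: "D f = (\<lambda>w. cce_d L f w + cce_partial L f w)"
  by (simp add: cce_diff_def)

lemma cce_diff_tensor_coalg: "f \<in> tensor_coalg L \<Longrightarrow> D f \<in> tensor_coalg L"
  unfolding cce_diff_eq by (rule coder_tensor_coalg[OF coalg_linear_cce_component])

text \<open>The \<open>T\<close> of the perturbation argument, in the form that
  \<open>H_homotopy\<close> asks for; \<open>defect_eq\<close> exhibits it through the bracket part,
  which shows its effect on lengths.\<close>

definition defect :: "('a list \<Rightarrow> 'k) \<Rightarrow> 'a list \<Rightarrow> 'k"
  where "defect f = f - coaug (counit f) - D (homotopy f) - homotopy (D f)"

lemma defect_eq:
  assumes f: "f \<in> tensor_coalg L"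
  shows "defect f w = - (cce_partial L (homotopy f) w + homotopy (cce_partial L f) w)"
proof -
  have "homotopy (D f) w = homotopy (cce_d L f) w + homotopy (cce_partial L f) w"
    unfolding cce_diff_split
    homotopy_add[OF cce_d_tensor_coalg[OF f] cce_partial_tensor_coalg[OF f]] ..
  then show ?thesis
    using cce_d_homotopy[OF f, of w] unfolding defect_def
    by (simp add: cce_diff_split algebra_simps)
qed

lemma length_eq_sum_list: "(\<Sum>b\<leftarrow>w. 1) = length w"
  by (simp add: sum_list_triv)

lemma homotopy_support:
  assumes f: "f \<in> tensor_coalg L" and nz: "homotopy f w \<noteq> 0"
  shows "\<exists>m. f m \<noteq> 0 \<and> length m = length w" "\<exists>m. f m \<noteq> 0 \<and> wdeg L m + 1 = wdeg L w"
proof -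
  have "s_coder f w \<noteq> 0" using nz unfolding homotopy_eq[OF f] length_inverse_def by auto
  then show "\<exists>m. f m \<noteq> 0 \<and> length m = length w" "\<exists>m. f m \<noteq> 0 \<and> wdeg L m + 1 = wdeg L w"
    unfolding s_coder_def
    using coder_support[OF coalg_linear_s_component homogeneous_s_component f]
      coder_support[OF coalg_linear_s_component homogeneous_length_s_component f]
    unfolding length_eq_sum_list wdeg_def by simp_all
qed

lemma cce_partial_support:
  assumes f: "f \<in> tensor_coalg L" and nz: "cce_partial L f w \<noteq> 0"
  shows "\<exists>m. f m \<noteq> 0 \<and> length m = length w + 1" "\<exists>m. f m \<noteq> 0 \<and> wdeg L m = wdeg L w + 1"
  using nz coder_support[OF coalg_linear_partial_component homogeneous_partial_component(1) f]
      coder_support[OF coalg_linear_partial_component homogeneous_partial_component(2) f]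
  unfolding cce_partial_def length_eq_sum_list wdeg_def by simp_all

text \<open>The bracket part removes one letter and lowers the degree by one; the homotopy keeps the
  length and raises the degree by one.\<close>

lemma defect_support:
  assumes f: "f \<in> tensor_coalg L" and nz: "defect f w \<noteq> 0"
  shows "\<exists>m. f m \<noteq> 0 \<and> length m = length w + 1" "\<exists>m. f m \<noteq> 0 \<and> wdeg L m = wdeg L w"
proof -
  from nz have "cce_partial L (homotopy f) w \<noteq> 0 \<or> homotopy (cce_partial L f) w \<noteq> 0"
    unfolding defect_eq[OF f] by auto
  then have "(\<exists>m. f m \<noteq> 0 \<and> length m = length w + 1) \<and> (\<exists>m. f m \<noteq> 0 \<and> wdeg L m = wdeg L w)"
  proof
    assume "cce_partial L (homotopy f) w \<noteq> 0"
    note P = cce_partial_support[OF homotopy_tensor_coalg[OF f] this]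
    from P(1) obtain m where "homotopy f m \<noteq> 0" "length m = length w + 1" by blast
    then have 1: "\<exists>m. f m \<noteq> 0 \<and> length m = length w + 1" using homotopy_support(1)[OF f, of m] by simp
    from P(2) obtain m' where "homotopy f m' \<noteq> 0" "wdeg L m' = wdeg L w + 1" by blast
    then have "\<exists>m. f m \<noteq> 0 \<and> wdeg L m = wdeg L w" using homotopy_support(2)[OF f, of m'] by simp
    with 1 show ?thesis ..
  next
    assume "homotopy (cce_partial L f) w \<noteq> 0"
    note P = homotopy_support[OF cce_partial_tensor_coalg[OF f] this]
    from P(1) obtain m where "cce_partial L f m \<noteq> 0" "length m = length w" by blast
    then have 1: "\<exists>m. f m \<noteq> 0 \<and> length m = length w + 1" using cce_partial_support(1)[OF f, of m] by simp
    from P(2) obtain m' where "cce_partial L f m' \<noteq> 0" "wdeg L m' + 1 = wdeg L w" by blast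
    then have "\<exists>m. f m \<noteq> 0 \<and> wdeg L m = wdeg L w" using cce_partial_support(2)[OF f, of m'] by simp
    with 1 show ?thesis ..
  qed
  then show "\<exists>m. f m \<noteq> 0 \<and> length m = length w + 1" "\<exists>m. f m \<noteq> 0 \<and> wdeg L m = wdeg L w" by blast+
qed

lemma sym_coalg_add:
  assumes "f \<in> W" "g \<in> W" shows "(\<lambda>w. f w + g w) \<in> W"
proof (rule sym_coalgI)
  show "f (u @ [x, y] @ v) + g (u @ [x, y] @ v)
    = (-1) ^ ((deg L x + 1) * (deg L y + 1)) * (f (u @ [y, x] @ v) + g (u @ [y, x] @ v))" for u x y v
    using sym_coalg_swap[OF assms(1), of u x y v] sym_coalg_swap[OF assms(2), of u x y v]
    by (simp only: distrib_left)
qed (intro tensor_coalg_add sym_tensor assms)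

lemma sym_coalg_scale:
  assumes "f \<in> W" shows "(\<lambda>w. r * f w) \<in> W"
proof (rule sym_coalgI)
  show "r * f (u @ [x, y] @ v)
    = (-1) ^ ((deg L x + 1) * (deg L y + 1)) * (r * f (u @ [y, x] @ v))" for u x y v
    using sym_coalg_swap[OF assms, of u x y v] by (simp only: mult.left_commute)
qed (intro tensor_coalg_scale sym_tensor assms)

lemma coaug_eq: "coaug r = (\<lambda>w. r * word [] w)"
  by (auto simp: coaug_def word_def)

lemma coaug_sym_coalg: "coaug r \<in> W"
  unfolding coaug_eq
  by (rule sym_coalg_scale, rule sym_coalgI, rule tensor_coalg_word) (auto simp: word_def)

lemma sym_coalg_diff: "f \<in> W \<Longrightarrow> g \<in> W \<Longrightarrow> f - g \<in> W"
  using sym_coalg_add[of f "\<lambda>w. - 1 * g w"] sym_coalg_scale[of g "-1"]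
  by (simp add: fun_diff_def)

lemma coder_coaug:
  assumes "coalg_linear L (scl L) \<beta>" "\<beta> (word []) = 0"
  shows "coder L k \<beta> (coaug r) = (\<lambda>w. 0)"
  unfolding coaug_eq
  using coder_linear(2)[OF assms(1) tensor_coalg_word, of "[]" k r] coder_word_Nil[OF assms] by simp

lemma cce_diff_add: "f \<in> tensor_coalg L \<Longrightarrow> g \<in> tensor_coalg L \<Longrightarrow> D (\<lambda>w. f w + g w) = (\<lambda>w. D f w + D g w)"
  unfolding cce_diff_eq by (rule coder_linear(1)[OF coalg_linear_cce_component])

lemma cce_diff_scale: "f \<in> tensor_coalg L \<Longrightarrow> D (\<lambda>w. r * f w) = (\<lambda>w. r * D f w)"
  unfolding cce_diff_eq by (rule coder_linear(2)[OF coalg_linear_cce_component])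

lemma cce_act_add: "f \<in> tensor_coalg L \<Longrightarrow> g \<in> tensor_coalg L \<Longrightarrow>
    cce_act L x (\<lambda>w. f w + g w) = (\<lambda>w. cce_act L x f w + cce_act L x g w)"
  unfolding cce_act_def by (rule coder_linear(1)[OF coalg_linear_act_component])

lemma act_tensor_coalg: "f \<in> tensor_coalg L \<Longrightarrow> cce_act L x f \<in> tensor_coalg L"
  unfolding cce_act_def by (rule coder_tensor_coalg[OF coalg_linear_act_component])

lemma homotopy_act:
  assumes x: "x \<in> grade L 0" and s: "\<And>y. s (brk L x y) = brk L x (s y)" and f: "f \<in> tensor_coalg L"
  shows "cce_act L x (homotopy f) = homotopy (cce_act L x f)"
proof -
  have *: "cce_act L x (s_coder f) = s_coder (cce_act L x f)"
  proof
    fix w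
    have "cce_act L x (s_coder f) w = (-1) ^ (0 * 1) * s_coder (cce_act L x f) w
        + coder L (0 + 1) (\<lambda>_. 0) f w"
      unfolding s_coder_def cce_act_def
      by (rule coder_commutatorI[OF coalg_linear_act_component homogeneous_act_component[OF x]
            coalg_linear_s_component homogeneous_s_component _ _ order_refl slice_tensor_coalg _ f])
        (simp_all add: tau_coder[unfolded One_nat_def] s)
    then show "cce_act L x (s_coder f) w = s_coder (cce_act L x f) w"
      by (simp add: coder_def)
  qed
  have "cce_act L x (homotopy f) = length_inverse (cce_act L x (s_coder f))"
    unfolding homotopy_eq[OF f] cce_act_def
    by (rule length_inverse_coder[OF s_coder_tensor_coalg[OF f], where l = "brk L x"]) simp
  then show ?thesis by (simp add: * homotopy_eq[OF act_tensor_coalg[OF f]])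
qed

lemma defect_sym_coalg: "f \<in> W \<Longrightarrow> defect f \<in> W"
  unfolding defect_def
  by (intro sym_coalg_diff coaug_sym_coalg cce_diff_sym_coalg homotopy_sym_coalg)

lemma perturbation_defect: "perturbation W defect homotopy"
proof
  fix f g assume f: "f \<in> W" and g: "g \<in> W"
  show "f - g \<in> W" using f g by (rule sym_coalg_diff)
  note ft = sym_tensor[OF f] and gt = sym_tensor[OF g]
  show "homotopy (f + g) = homotopy f + homotopy g"
    using homotopy_add[OF ft gt] by (simp add: plus_fun_def)
  show "defect (f + g) = defect f + defect g"
  proof
    fix w
    show "defect (f + g) w = (defect f + defect g) w"
      using cce_diff_add[OF homotopy_tensor_coalg[OF ft] homotopy_tensor_coalg[OF gt]]
        homotopy_add[OF cce_diff_tensor_coalg[OF ft] cce_diff_tensor_coalg[OF gt]]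
      by (simp add: defect_def plus_fun_def homotopy_add[OF ft gt] cce_diff_add[OF ft gt]
          coaug_def counit_def)
  qed
next
  show "0 \<in> W"
    using coaug_sym_coalg[of 0] by (simp add: coaug_eq zero_fun_def)
next
  fix f assume f: "f \<in> W"
  show "defect f \<in> W" "homotopy f \<in> W"
    using f by (rule defect_sym_coalg homotopy_sym_coalg)+
  have pow: "(defect ^^ n) f \<in> W" for n
    by (induction n) (simp_all add: f defect_sym_coalg)
  \<comment> \<open>Each application of \<open>defect\<close> costs one letter, so a power exceeding
    every word length in \<open>f\<close> kills it.\<close>
  have lower: "\<exists>m. f m \<noteq> 0 \<and> length m = length w + n" if "(defect ^^ n) f w \<noteq> 0" for n w
    using that
  proof (induction n arbitrary: w)
    case (Suc n)
    then obtain m where "(defect ^^ n) f m \<noteq> 0" "length m = length w + 1"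
      using defect_support(1)[OF sym_tensor[OF pow], of n w] by auto
    then show ?case using Suc.IH[of m] by simp
  qed auto
  have "finite (length ` {m. f m \<noteq> 0})"
    using sym_tensor[OF f] by (simp add: tensor_coalg_def)
  then obtain n where n: "\<forall>k\<in>length ` {m. f m \<noteq> 0}. k < n"
    using finite_nat_set_iff_bounded by blast
  have "(defect ^^ n) f w = 0" for w
    using lower[of n w] n by force
  then show "\<exists>n. (defect ^^ n) f = 0"
    by (intro exI[of _ n]) (simp add: fun_eq_iff)
qed

interpretation P: perturbation W defect homotopy by (rule perturbation_defect)

section \<open>The contraction for the full differential\<close>

definition contraction :: "('a list \<Rightarrow> 'k) \<Rightarrow> 'a list \<Rightarrow> 'k"
  where "contraction = P.H"

lemma contraction_sym_coalg: "f \<in> W \<Longrightarrow> contraction f \<in> W"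
  unfolding contraction_def by (rule P.H_in)

lemma contraction_add:
  "f \<in> W \<Longrightarrow> g \<in> W \<Longrightarrow> contraction (\<lambda>w. f w + g w) = (\<lambda>w. contraction f w + contraction g w)"
  using P.H_add[of f g] by (simp add: contraction_def plus_fun_def)

lemma contraction_scale:
  assumes "f \<in> W" shows "contraction (\<lambda>w. r * f w) = (\<lambda>w. r * contraction f w)"
  unfolding contraction_def
proof (rule P.H_commute[where A = "\<lambda>f w. r * f w", OF _ _ _ _ assms])
  fix f assume f: "f \<in> W"
  note ft = sym_tensor[OF f]
  show "(\<lambda>w. r * f w) \<in> W" using f by (rule sym_coalg_scale)
  show "(\<lambda>w. r * homotopy f w) = homotopy (\<lambda>w. r * f w)" by (rule homotopy_scale[OF ft, symmetric])
  show "(\<lambda>w. r * defect f w) = defect (\<lambda>w. r * f w)"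
    using cce_diff_scale[OF homotopy_tensor_coalg[OF ft]] homotopy_scale[OF cce_diff_tensor_coalg[OF ft]]
    by (simp add: fun_eq_iff defect_def homotopy_scale[OF ft] cce_diff_scale[OF ft]
        coaug_def counit_def right_diff_distrib)
qed (simp add: plus_fun_def distrib_left)

lemma contraction_hom:
  assumes "f \<in> sym_coalg_hom L n" shows "contraction f \<in> sym_coalg_hom L (n + 1)"
  unfolding contraction_def
proof (rule P.H_graded[OF _ _ _ _ assms])
  fix f assume "f \<in> sym_coalg_hom L n"
  then have f: "f \<in> W" "\<And>w. f w \<noteq> 0 \<Longrightarrow> wdeg L w = n" by (auto simp: sym_coalg_hom_def)
  show "defect f \<in> sym_coalg_hom L n"
    using f(2) defect_support(2)[OF sym_tensor[OF f(1)]] defect_sym_coalg[OF f(1)]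
    by (auto simp: sym_coalg_hom_def) metis
  show "homotopy f \<in> sym_coalg_hom L (n + 1)"
    using f(2) homotopy_support(2)[OF sym_tensor[OF f(1)]] homotopy_sym_coalg[OF f(1)]
    by (auto simp: sym_coalg_hom_def) metis
next
  show "0 \<in> sym_coalg_hom L (n + 1)" by (simp add: sym_coalg_hom_def P.zero)
  show "f + g \<in> sym_coalg_hom L (n + 1)"
    if "f \<in> sym_coalg_hom L (n + 1)" "g \<in> sym_coalg_hom L (n + 1)" for f g
    using that P.add[of f g] unfolding sym_coalg_hom_def
    by (auto simp: plus_fun_def) (metis add_0)
qed

lemma contraction_act:
  assumes x: "x \<in> grade L 0" and s: "\<And>y. s (brk L x y) = brk L x (s y)" and f: "f \<in> W"
  shows "contraction (cce_act L x f) = cce_act L x (contraction f)"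
  unfolding contraction_def
proof (rule P.H_commute[OF _ _ _ _ f])
  fix f assume f: "f \<in> W"
  note ft = sym_tensor[OF f]
  show "cce_act L x f \<in> W" by (rule cce_act_sym_coalg[OF x f])
  show "cce_act L x (f + g) = cce_act L x f + cce_act L x g" if "g \<in> W" for g
    using cce_act_add[OF ft sym_tensor[OF that]] by (simp add: plus_fun_def)
  show ah: "cce_act L x (homotopy f) = homotopy (cce_act L x f)"
    by (rule homotopy_act[OF x s ft])
  have act_diff: "cce_act L x (f - g) = cce_act L x f - cce_act L x g" if "f \<in> W" "g \<in> W" for f g
    using P.additive_diff[of "cce_act L x", OF _ that]
      cce_act_add[OF sym_tensor sym_tensor] by (simp add: plus_fun_def)
  \<comment> \<open>The action kills the coaugmentation and its values have counit 0, so it commutes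
    with the projection contained in \<open>defect\<close>.\<close>
  have act_coaug: "cce_act L x (coaug r) = 0" for r
    unfolding cce_act_def zero_fun_def by (rule coder_coaug[OF coalg_linear_act_component]) simp
  have "counit (cce_act L x f) = 0"
    by (simp add: counit_def cce_act_def coder_simps)
  then have coaug_act: "coaug (counit (cce_act L x f)) = 0"
    by (simp add: coaug_eq zero_fun_def)
  show "cce_act L x (defect f) = defect (cce_act L x f)"
    unfolding defect_def
    by (simp add: act_diff sym_coalg_diff coaug_sym_coalg cce_diff_sym_coalg homotopy_sym_coalg f
        act_coaug coaug_act ah cce_act_cce_diff[OF x homotopy_tensor_coalg[OF ft]]
        cce_act_cce_diff[OF x ft] homotopy_act[OF x s cce_diff_tensor_coalg[OF ft]])
qed

lemma contraction_homotopy: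
  assumes "f \<in> W"
  shows "D (contraction f) w + contraction (D f) w = f w - coaug (counit f) w"
proof -
  \<comment> \<open>Coderivations have no coefficient on the empty word; hence the projection to the
    coaugmentation kills the images of \<open>D\<close> and of \<open>defect\<close>.\<close>
  have nil: "D f [] = 0" "homotopy f [] = 0" for f
    by (simp_all add: cce_diff_eq homotopy_def s_coder_def coder_simps)
  have "D (P.H f) + P.H (D f) = f - coaug (counit f)"
  proof (rule P.H_homotopy[OF _ _ _ _ _ _ _ _ assms])
    fix f assume f: "f \<in> W"
    show "D f \<in> W" by (rule cce_diff_sym_coalg[OF f])
    show "D (f + g) = D f + D g" if "g \<in> W" for g
      using cce_diff_add[OF sym_tensor[OF f] sym_tensor[OF that]] by (simp add: plus_fun_def)
    show "D (D f) = 0" using cce_diff_cce_diff[OF f] by (simp add: zero_fun_def)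
    show "coaug (counit f) \<in> W" by (rule coaug_sym_coalg)
    show "D (coaug (counit f)) = 0"
      unfolding cce_diff_eq zero_fun_def
      by (rule coder_coaug[OF coalg_linear_cce_component]) (simp add: cce_component_word)
    show "coaug (counit (D f)) = (0 :: 'a list \<Rightarrow> 'k)"
      by (simp add: counit_def nil coaug_eq zero_fun_def)
    show "coaug (counit (defect f)) = (0 :: 'a list \<Rightarrow> 'k)"
      by (simp add: counit_def defect_def nil coaug_def zero_fun_def)
    show "defect f = f - coaug (counit f) - D (homotopy f) - homotopy (D f)"
      by (rule defect_def)
  qed
  from fun_cong[OF this, of w] show ?thesis by (simp add: contraction_def)
qed

end

section \<open>The cone\<close>

text \<open>The map sends \<open>Y + sZ\<close> to \<open>sY\<close>. From \<open>d(sY) = Y\<close>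
  one gets \<open>ds = Id\<close> in degree 0 and \<open>sd = Id\<close> in degree 1, while the
  other composites vanish.\<close>

lemma contractible_cone:
  fixes scale :: "'k::field_char_0 \<Rightarrow> 'g::ab_group_add \<Rightarrow> 'g"
  assumes "lie_algebra scale bracket"
    and B: "\<not> module.dependent scale B" "module.span scale B = UNIV"
  shows "contractible_dg_lie_algebra (cone scale bracket B) (\<lambda>(Y, Z). (0, Y))"
proof -
  interpret lie_algebra scale bracket by fact
  let ?L = "cone scale bracket B"
  interpret dg_lie_algebra ?L by (rule dg_lie_algebra_cone[OF assms])
  show ?thesis
  proof
    show "(case x + y of (Y, Z) \<Rightarrow> (0 :: 'g, Y)) = (case x of (Y, Z) \<Rightarrow> (0, Y)) + (case y of (Y, Z) \<Rightarrow> (0, Y))" for x y :: "'g \<times> 'g"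
      by (cases x; cases y) simp
    show "(case scl ?L r x of (Y, Z) \<Rightarrow> (0, Y)) = scl ?L r (case x of (Y, Z) \<Rightarrow> (0, Y))" for r x
      by (cases x) (simp add: cone_def)
    show "dif ?L (case x of (Y, Z) \<Rightarrow> (0, Y)) + (case dif ?L x of (Y, Z) \<Rightarrow> (0, Y)) = x" for x
      by (cases x) (simp add: cone_def)
    show "(case x of (Y, Z) \<Rightarrow> (0, Y)) \<in> grade ?L (n + 1)" if "x \<in> grade ?L n" for x n
      using that unfolding grade_def[of _ n]
    proof (induction rule: V.span_induct_alt)
      case base
      then show ?case using grade_simps(1) by (simp add: zero_prod_def)
    next
      case (step c x y)
      have "(case x of (Y, Z) \<Rightarrow> (0, Y)) \<in> grade ?L (n + 1)"
      proof -
        \<comment> \<open>The degree in the cone is read off the second coordinate, so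
          \<open>(0, b)\<close> has degree 1 only for nonzero \<open>b\<close>.\<close>
        have "0 \<notin> B" using B(1) dependent_zero by blast
        from step(1) consider b where "b \<in> B" "x = (b, 0)" "n = 0" | b where "b \<in> B" "x = (0, b)"
          by (auto simp: cone_def)
        then show ?thesis
        proof cases
          case 1
          then have "b \<noteq> 0" using \<open>0 \<notin> B\<close> by blast
          then show ?thesis
            using 1 basis_grade[of "(0, b)"] by (auto simp: cone_def)
        next
          case 2
          then show ?thesis using grade_simps(1) by (simp add: zero_prod_def)
        qed
      qed
      then have "scl ?L c (case x of (Y, Z) \<Rightarrow> (0, Y)) + (case y of (Y, Z) \<Rightarrow> (0, Y)) \<in> grade ?L (n + 1)"
        using step(2) grade_simps(3) unfolding grade_def by (intro V.span_add)
      then show ?case by (cases x; cases y) (simp add: cone_def)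
    qed
  qed
qed

theorem theorem3p4p1:
  fixes scale :: "'k::field_char_0 \<Rightarrow> 'g::ab_group_add \<Rightarrow> 'g"
    and bracket :: "'g \<Rightarrow> 'g \<Rightarrow> 'g"
    and B :: "'g set"
  assumes "lie_algebra scale bracket"
    and "reductive scale bracket"
    and "\<not> module.dependent scale B" and "module.span scale B = UNIV"
  shows "\<exists>h. equivariant_contracting_homotopy scale bracket B h"
proof -
  interpret lie_algebra scale bracket by fact
  let ?L = "cone scale bracket B"
  interpret contractible_dg_lie_algebra ?L "\<lambda>(Y, Z). (0, Y)"
    by (rule contractible_cone[OF assms(1,3,4)])
  have "bracket 0 y = 0" for y
  proof -
    interpret l: Vector_Spaces.linear scale scale "\<lambda>x. bracket x y" by (rule linear_left)
    show ?thesis by (rule l.zero)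
  qed
  \<comment> \<open>This is \<open>s[Y, Z] = [Y, sZ]\<close>, the source of equivariance.\<close>
  then have s: "(case brk ?L (Y, 0) y of (Y, Z) \<Rightarrow> (0, Y)) = brk ?L (Y, 0) (case y of (Y, Z) \<Rightarrow> (0, Y))" for Y y
    using brk_simps(6)[of "(Y, 0)"] by (cases y) (simp add: cone_def zero_prod_def)
  have g: "(Y, 0) \<in> grade ?L 0" for Y
  proof -
    have "module_hom scale (scl ?L) (\<lambda>Y. (Y, 0))" by unfold_locales (auto simp: cone_def)
    then have "(\<lambda>Y. (Y, 0)) ` span B = V.span ((\<lambda>b. (b, 0)) ` B)"
      by (rule module_hom.span_image[symmetric])
    then have "(Y, 0) \<in> V.span ((\<lambda>b. (b, 0)) ` B)"
      using assms(4) by (metis UNIV_I image_eqI)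
    moreover have "(\<lambda>b. (b, 0)) ` B \<subseteq> {b \<in> basis ?L. deg ?L b = 0}" by (auto simp: cone_def)
    ultimately show ?thesis
      unfolding grade_def by (meson V.span_mono subsetD)
  qed
  show ?thesis
    unfolding equivariant_contracting_homotopy_def Let_def weil_coalg_def weil_diff_def weil_hom_def
      weil_act_def
    using contraction_sym_coalg contraction_add contraction_scale contraction_hom
      contraction_act[OF g s] contraction_homotopy
    by (intro exI[of _ contraction]) blast
qed

end
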